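(* Let $k \geq 6$ and $r \geq 3$ be integers, and let $H$ be the graph consisting of $k$ pairwise vertex-disjoint cycles, each of order $r$. Every graph $G$ with average degree at least $\tfrac{4}{3}kr$ contains $H$ as a minor.
   Context: Graphs are finite and simple. The average degree of a graph $G$ is $d(G) = 2|E(G)|/|V(G)|$. A graph $H$ is a minor of $G$ if a graph isomorphic to $H$ can be obtained from $G$ by a sequence of vertex deletions, edge deletions and edge contractions. *)

theory Defs
  imports Complex_Main "Graph_Theory.Pair_Digraph" "Graph_Theory.Digraph_Isomorphism"
begin

text \<open>A finite simple graph is a \<^locale>\<open>pair_graph\<close>: every undirected edge \<open>uv\<close> is stored as the two
  arcs \<open>(u, v)\<close> and \<open>(v, u)\<close>.\<close>

definition uedges :: "'a pair_pre_digraph \<Rightarrow> 'a set set" where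
  "uedges G = (\<lambda>(u, v). {u, v}) ` parcs G"

definition avg_degree :: "'a pair_pre_digraph \<Rightarrow> real" where
  "avg_degree G = 2 * real (card (uedges G)) / real (card (pverts G))"

definition delete_vertex :: "'a \<Rightarrow> 'a pair_pre_digraph \<Rightarrow> 'a pair_pre_digraph" where
  "delete_vertex v G =
     \<lparr> pverts = pverts G - {v}, parcs = {e \<in> parcs G. fst e \<noteq> v \<and> snd e \<noteq> v} \<rparr>"

definition delete_edge :: "'a \<Rightarrow> 'a \<Rightarrow> 'a pair_pre_digraph \<Rightarrow> 'a pair_pre_digraph" where
  "delete_edge u v G = \<lparr> pverts = pverts G, parcs = parcs G - {(u, v), (v, u)} \<rparr>"

text \<open>Contracting \<open>uv\<close> identifies \<open>v\<close> with \<open>u\<close> and reuses \<open>u\<close> as the name of the new vertex; the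
  loop is dropped, and parallel edges merge because arcs form a set.\<close>

definition contract_edge :: "'a \<Rightarrow> 'a \<Rightarrow> 'a pair_pre_digraph \<Rightarrow> 'a pair_pre_digraph" where
  "contract_edge u v G =
     (let f = (\<lambda>x. if x = v then u else x)
      in \<lparr> pverts = f ` pverts G,
           parcs = {(f x, f y) |x y. (x, y) \<in> parcs G \<and> f x \<noteq> f y} \<rparr>)"

inductive minor_step :: "'a pair_pre_digraph \<Rightarrow> 'a pair_pre_digraph \<Rightarrow> bool" where
  delete_vertex: "v \<in> pverts G \<Longrightarrow> minor_step G (delete_vertex v G)"
| delete_edge: "(u, v) \<in> parcs G \<Longrightarrow> minor_step G (delete_edge u v G)"
| contract_edge: "(u, v) \<in> parcs G \<Longrightarrow> minor_step G (contract_edge u v G)"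

definition is_minor :: "'b pair_pre_digraph \<Rightarrow> 'a pair_pre_digraph \<Rightarrow> bool" where
  "is_minor H G \<longleftrightarrow> (\<exists>G'. minor_step\<^sup>*\<^sup>* G G' \<and> digraph_iso (with_proj G') (with_proj H))"

text \<open>The \<open>i\<close>-th cycle is \<open>(i, 0), (i, 1), \<dots>, (i, r - 1), (i, 0)\<close>. This is a disjoint union of
  simple cycles only for \<open>r \<ge> 3\<close>.\<close>

definition disjoint_cycles :: "nat \<Rightarrow> nat \<Rightarrow> (nat \<times> nat) pair_pre_digraph" where
  "disjoint_cycles k r =
     \<lparr> pverts = {..<k} \<times> {..<r},
       parcs = {((i, a), (i, b)) |i a b. i < k \<and> a < r \<and> b < r \<and>
                  (b = Suc a mod r \<or> a = Suc b mod r)} \<rparr>"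

lemma card_parcs:
  assumes "pair_graph G"
  shows "card (parcs G) = 2 * card (uedges G)"
proof -
  interpret pair_graph G by fact
  have fin: "finite (uedges G)" by (simp add: uedges_def)
  have *: "card {a \<in> parcs G. (\<lambda>(u, v). {u, v}) a = e} = 2" if "e \<in> uedges G" for e
  proof -
    from that obtain u v where uv: "(u, v) \<in> parcs G" "e = {u, v}" by (auto simp: uedges_def)
    then have "u \<noteq> v" "(v, u) \<in> parcs G" by (auto dest: no_loops' arcs_symmetric)
    with uv have "{a \<in> parcs G. (\<lambda>(u, v). {u, v}) a = e} = {(u, v), (v, u)}"
      by (auto simp: doubleton_eq_iff)
    with \<open>u \<noteq> v\<close> show ?thesis by simp
  qed
  have "card (parcs G) = (\<Sum>e\<in>uedges G. card {a \<in> parcs G. (\<lambda>(u, v). {u, v}) a = e})"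
    using sum.group[of "parcs G" "uedges G" "\<lambda>(u, v). {u, v}" "\<lambda>_. 1::nat"] fin
    by (simp add: uedges_def)
  then show ?thesis using * by simp
qed

lemma pair_graph_iff:
  "pair_graph G \<longleftrightarrow> finite (pverts G) \<and> parcs G \<subseteq> pverts G \<times> pverts G \<and>
     sym (parcs G) \<and> irrefl (parcs G)"
proof
  assume "pair_graph G"
  then interpret pair_graph G .
  show "finite (pverts G) \<and> parcs G \<subseteq> pverts G \<times> pverts G \<and> sym (parcs G) \<and> irrefl (parcs G)"
    by (auto simp: sym_def irrefl_def dest: in_arcsD1 in_arcsD2 no_loops' arcs_symmetric)
next
  assume *: "finite (pverts G) \<and> parcs G \<subseteq> pverts G \<times> pverts G \<and>
     sym (parcs G) \<and> irrefl (parcs G)"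
  then have "finite (parcs G)" by (meson finite_SigmaI finite_subset)
  with * show "pair_graph G"
    by unfold_locales (auto simp: symmetric_def irrefl_def)
qed

lemma minor_step_pair_graph:
  assumes "minor_step G G'" "pair_graph G"
  shows "pair_graph G'"
  using assms
proof cases
  case (delete_vertex v)
  then show ?thesis using assms(2)
    by (auto simp: pair_graph_iff delete_vertex_def sym_def irrefl_def)
next
  case (delete_edge u v)
  then show ?thesis using assms(2)
    by (auto simp: pair_graph_iff delete_edge_def sym_def irrefl_def)
next
  case (contract_edge u v)
  define f where "f = (\<lambda>x. if x = v then u else x)"
  have G': "pverts G' = f ` pverts G" "parcs G' = {(f x, f y) |x y. (x, y) \<in> parcs G \<and> f x \<noteq> f y}"
    using contract_edge by (simp_all add: contract_edge_def f_def)
  from assms(2) have G: "finite (pverts G)" "parcs G \<subseteq> pverts G \<times> pverts G" "sym (parcs G)"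
    by (simp_all add: pair_graph_iff)
  have "sym (parcs G')"
  proof (rule symI)
    fix a b assume "(a, b) \<in> parcs G'"
    then obtain x y where "a = f x" "b = f y" "(x, y) \<in> parcs G" "f x \<noteq> f y"
      unfolding G' by blast
    moreover from this G(3) have "(y, x) \<in> parcs G" by (blast dest: symD)
    ultimately show "(b, a) \<in> parcs G'" unfolding G' by fastforce
  qed
  moreover have "irrefl (parcs G')" by (auto simp: G'(2) irrefl_def)
  moreover have "parcs G' \<subseteq> pverts G' \<times> pverts G'" using G(2) unfolding G' by blast
  ultimately show ?thesis using G(1) by (simp add: pair_graph_iff G'(1))
qed

lemma disjoint_cycles_pair_graph:
  assumes "r \<ge> 2"
  shows "pair_graph (disjoint_cycles k r)"
proof -
  have "a \<noteq> Suc a mod r" if "a < r" for a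
    using that assms by (cases "Suc a = r") auto
  then show ?thesis
    by (auto simp: pair_graph_iff disjoint_cycles_def sym_def irrefl_def)
qed

end

theory Submission
  imports Defs
begin

text \<open>The heart of the proof is a decomposition of a graph with at least \<open>c n\<close> edges into two disjoint
  parts \<open>A\<close>, \<open>B\<close> of densities \<open>p c - (1 - p)\<close> and \<open>(1 - p) c - p\<close>; these add up to \<open>c - 1\<close>. Start with the
  fractional partition that gives the share \<open>p\<close> of every vertex to \<open>A\<close>, where both density requirements
  \<open>p c\<close>, \<open>(1 - p) c\<close> are met, and round it. Two nonadjacent fractional vertices can be moved together
  so that neither excess decreases, because the edge counts are linear along such a move; so the
  fractional vertices eventually form a clique \<open>K\<close>. On a clique the edge count has the quadratic part
  \<open>((\<Sum>y)\<^sup>2 - \<Sum>y\<^sup>2) / 2\<close>, so at the price of at most \<open>|K| / 8\<close> one may add \<open>\<Sum>y\<^sup>2 / 2\<close>, which makes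
  all moves inside \<open>K\<close> convex, and the rounding continues until one fractional vertex is left.
  The difference between \<open>c\<close> and \<open>c - 1\<close> pays for \<open>K\<close> and for this last vertex.

  A graph of density at least \<open>2kr/3 - 1\<close> therefore contains \<open>k\<close> disjoint cycles of length at least \<open>r\<close>:
  for \<open>k = 1\<close> this follows from the Erdos-Gallai theorem, and for \<open>k \<ge> 2\<close> either a clique on \<open>kr\<close>
  vertices gives the cycles or the decomposition with \<open>p \<approx> 1/2\<close> reduces \<open>k\<close> to its two halves.\<close>

section \<open>Rounding fractional bipartitions\<close>

text \<open>For the 0-1 adjacency matrix of a graph this is twice the number of edges inside
  \<open>A\<close>.\<close>

definition vol :: "('a \<Rightarrow> 'a \<Rightarrow> real) \<Rightarrow> 'a set \<Rightarrow> real" where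
  "vol w A = (\<Sum>u\<in>A. \<Sum>v\<in>A. w u v)"

text \<open>Extends \<open>vol\<close> from vertex sets, seen as 0-1 vectors, to fractional
  ones.\<close>

definition quad :: "('a \<Rightarrow> 'a \<Rightarrow> real) \<Rightarrow> 'a set \<Rightarrow> ('a \<Rightarrow> real) \<Rightarrow> real" where
  "quad w V x = (\<Sum>u\<in>V. \<Sum>v\<in>V. w u v * x u * x v)"

text \<open>Twice the number of edges exceeding density \<open>\<alpha>\<close> at the fractional vertex set \<open>x\<close>. The penalty vanishes
  at integral points and adds \<open>\<Sum>y\<^sup>2\<close> over \<open>K\<close> to the quadratic part in a direction \<open>y\<close>.\<close>

definition excess :: "('a \<Rightarrow> 'a \<Rightarrow> real) \<Rightarrow> 'a set \<Rightarrow> real \<Rightarrow> 'a set \<Rightarrow> ('a \<Rightarrow> real) \<Rightarrow> real" where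
  "excess w V \<alpha> K x = quad w V x - 2 * \<alpha> * sum x V - (\<Sum>v\<in>V. of_bool (v \<in> K) * (x v * (1 - x v)))"

definition fractional :: "'a set \<Rightarrow> ('a \<Rightarrow> real) \<Rightarrow> 'a set" where
  "fractional V x = {v \<in> V. 0 < x v \<and> x v < 1}"

text \<open>The form is the quadratic part of \<open>excess\<close> along the direction
  \<open>(a, b)\<close> at \<open>u\<close>, \<open>v\<close>. Outside \<open>K\<close> the
  condition forces \<open>w u v = 0\<close>; inside \<open>K\<close> the squares supplied by the
  penalty also admit adjacent vertices.\<close>

definition convex_pair :: "('a \<Rightarrow> 'a \<Rightarrow> real) \<Rightarrow> 'a set \<Rightarrow> 'a \<Rightarrow> 'a \<Rightarrow> bool" where
  "convex_pair w K u v \<longleftrightarrow>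
     (\<forall>a b. 2 * a * b * w u v + of_bool (u \<in> K) * a\<^sup>2 + of_bool (v \<in> K) * b\<^sup>2 \<ge> 0)"

lemma sum_two_points:
  fixes g :: "'a \<Rightarrow> real"
  assumes "finite V" "u \<in> V" "v \<in> V" "u \<noteq> v"
  shows "(\<Sum>z\<in>V. g z * (if z = u then a else if z = v then b else 0)) = g u * a + g v * b"
proof -
  have "(\<Sum>z\<in>V. g z * (if z = u then a else if z = v then b else 0))
      = (\<Sum>z\<in>V. (if z = u then g z * a else 0) + (if z = v then g z * b else 0))"
    using assms(4) by (intro sum.cong) auto
  then show ?thesis using assms by (simp add: sum.distrib)
qed

lemma quad_add:
  assumes sym: "\<And>u v. w u v = w v u"
  shows "quad w V (\<lambda>z. x z + t * y z)
    = quad w V x + 2 * t * (\<Sum>z\<in>V. (\<Sum>v\<in>V. w z v * x v) * y z) + t\<^sup>2 * quad w V y"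
proof -
  have 1: "(\<Sum>u\<in>V. \<Sum>v\<in>V. w u v * x u * y v) = (\<Sum>z\<in>V. (\<Sum>v\<in>V. w z v * x v) * y z)"
    by (subst sum.swap) (auto simp: sum_distrib_left sum_distrib_right mult_ac sym intro!: sum.cong)
  have 2: "(\<Sum>u\<in>V. \<Sum>v\<in>V. w u v * y u * x v) = (\<Sum>z\<in>V. (\<Sum>v\<in>V. w z v * x v) * y z)"
    by (simp add: sum_distrib_left sum_distrib_right mult_ac)
  have "quad w V (\<lambda>z. x z + t * y z) = quad w V x + t * (\<Sum>u\<in>V. \<Sum>v\<in>V. w u v * x u * y v)
      + t * (\<Sum>u\<in>V. \<Sum>v\<in>V. w u v * y u * x v) + t\<^sup>2 * quad w V y"
    unfolding quad_def by (simp add: algebra_simps sum.distrib sum_distrib_left power2_eq_square)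
  then show ?thesis unfolding 1 2 by simp
qed

text \<open>Since \<open>w\<close> has zero diagonal, moving two coordinates produces only a cross
  term; the squares come from the penalty. The slopes \<open>p\<close>, \<open>q\<close> do not
  depend on \<open>a\<close>, \<open>b\<close>, \<open>t\<close>, so a direction can be chosen once
  they are known.\<close>

lemma excess_line:
  fixes w :: "'a \<Rightarrow> 'a \<Rightarrow> real"
  assumes "finite V" and sym: "\<And>u v. w u v = w v u" and irr: "\<And>u. w u u = 0"
    and uv: "u \<in> V" "v \<in> V" "u \<noteq> v"
  obtains p q where "\<forall>a b t. excess w V \<alpha> K (x(u := x u + t * a, v := x v + t * b)) =
    excess w V \<alpha> K x + t * (a * p + b * q)
      + t\<^sup>2 * (2 * a * b * w u v + of_bool (u \<in> K) * a\<^sup>2 + of_bool (v \<in> K) * b\<^sup>2)"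
proof -
  define g where "g z = 2 * (\<Sum>v\<in>V. w z v * x v) - 2 * \<alpha> - of_bool (z \<in> K) * (1 - 2 * x z)" for z
  have "excess w V \<alpha> K (x(u := x u + t * a, v := x v + t * b)) =
    excess w V \<alpha> K x + t * (a * g u + b * g v)
      + t\<^sup>2 * (2 * a * b * w u v + of_bool (u \<in> K) * a\<^sup>2 + of_bool (v \<in> K) * b\<^sup>2)" for a b t
  proof -
    define y where "y z = (if z = u then a else if z = v then b else 0)" for z
    have upd: "x(u := x u + t * a, v := x v + t * b) = (\<lambda>z. x z + t * y z)"
      using uv(3) by (auto simp: y_def fun_eq_iff)
    have two: "(\<Sum>z\<in>V. h z * y z) = h u * a + h v * b" for h
      unfolding y_def using sum_two_points[OF assms(1) uv] by simp
    have "quad w V y = (\<Sum>z\<in>V. (\<Sum>v\<in>V. w z v * y v) * y z)"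
      unfolding quad_def by (simp add: sum_distrib_left sum_distrib_right mult_ac)
    also have "\<dots> = 2 * a * b * w u v"
      unfolding two by (simp add: irr sym[of v u])
    finally have qy: "quad w V y = 2 * a * b * w u v" .
    have y2: "(\<Sum>z\<in>V. of_bool (z \<in> K) * (y z)\<^sup>2) = of_bool (u \<in> K) * a\<^sup>2 + of_bool (v \<in> K) * b\<^sup>2"
      using two[of "\<lambda>z. of_bool (z \<in> K) * y z"] uv(3)
      by (simp add: y_def power2_eq_square mult_ac)
    have pen: "(\<Sum>z\<in>V. of_bool (z \<in> K) * ((x z + t * y z) * (1 - (x z + t * y z))))
       = (\<Sum>z\<in>V. of_bool (z \<in> K) * (x z * (1 - x z)))
         + t * (\<Sum>z\<in>V. (of_bool (z \<in> K) * (1 - 2 * x z)) * y z)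
         - t\<^sup>2 * (\<Sum>z\<in>V. of_bool (z \<in> K) * (y z)\<^sup>2)"
      unfolding sum_distrib_left sum.distrib[symmetric] sum_subtractf[symmetric]
      by (intro sum.cong) (auto simp: algebra_simps power2_eq_square)
    have lin: "(\<Sum>z\<in>V. x z + t * y z) = sum x V + t * (a + b)"
      using two[of "\<lambda>_. 1"] by (simp add: sum.distrib sum_distrib_left[symmetric])
    show ?thesis
      unfolding upd excess_def quad_add[OF sym] pen lin qy y2 two g_def
      by (simp add: algebra_simps)
  qed
  then show thesis using that by blast
qed

section \<open>Moving two coordinates inside the unit square\<close>

text \<open>Of the two opposite vectors orthogonal to the first slope vector, one has a nonnegative
  product with the second.\<close>

lemma exists_direction:
  fixes p\<^sub>1 p\<^sub>2 q\<^sub>1 q\<^sub>2 :: real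
  shows "\<exists>a b. (a \<noteq> 0 \<or> b \<noteq> 0) \<and> a * p\<^sub>1 + b * p\<^sub>2 \<ge> 0 \<and> a * q\<^sub>1 + b * q\<^sub>2 \<ge> 0"
proof (cases "p\<^sub>1 = 0 \<and> p\<^sub>2 = 0")
  case True
  then show ?thesis by (intro exI[of _ "if q\<^sub>1 \<ge> 0 then 1 else -1"] exI[of _ 0]) auto
next
  case False
  define e :: real where "e = (if p\<^sub>2 * q\<^sub>1 - p\<^sub>1 * q\<^sub>2 \<ge> 0 then 1 else -1)"
  from False show ?thesis
    by (intro exI[of _ "e * p\<^sub>2"] exI[of _ "- e * p\<^sub>1"]) (auto simp: e_def)
qed

lemma exit_time1:
  fixes x a :: real
  assumes "0 < x" "x < 1" "a \<noteq> 0"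
  shows "\<exists>t>0. (x + t * a = 0 \<or> x + t * a = 1) \<and> (\<forall>s. 0 \<le> s \<and> s \<le> t \<longrightarrow> 0 \<le> x + s * a \<and> x + s * a \<le> 1)"
proof (cases "a > 0")
  case True
  then show ?thesis using assms
    by (intro exI[of _ "(1 - x) / a"]) (auto simp: field_simps)
next
  case False
  with assms(3) have a: "a < 0" by simp
  have "0 \<le> x + s * a \<and> x + s * a \<le> 1" if "0 \<le> s" "s \<le> x / (- a)" for s
  proof -
    have "s * (- a) \<le> x" using that(2) a pos_le_divide_eq[of "- a" s x] by linarith
    moreover have "s * a \<le> 0" using that(1) a by (simp add: mult_nonneg_nonpos)
    ultimately show ?thesis using assms by (simp add: algebra_simps)
  qed
  then show ?thesis using assms a
    by (intro exI[of _ "x / (- a)"]) (auto simp: field_simps)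
qed

text \<open>The smaller of the two exit times works. The bounds are kept at all earlier times
  because the barrier is tested along the whole segment.\<close>

lemma exit_time:
  fixes x y a b :: real
  assumes "0 < x" "x < 1" "0 < y" "y < 1" "a \<noteq> 0 \<or> b \<noteq> 0"
  shows "\<exists>t>0. (x + t * a \<in> {0, 1} \<or> y + t * b \<in> {0, 1}) \<and>
    (\<forall>s. 0 \<le> s \<and> s \<le> t \<longrightarrow> 0 \<le> x + s * a \<and> x + s * a \<le> 1 \<and> 0 \<le> y + s * b \<and> y + s * b \<le> 1)"
proof (cases "a = 0 \<or> b = 0")
  case True
  then consider "a = 0" "b \<noteq> 0" | "b = 0" "a \<noteq> 0" using assms(5) by auto
  then show ?thesis
  proof cases
    case 1
    with exit_time1[OF assms(3,4)] show ?thesis using assms by fastforce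
  next
    case 2
    with exit_time1[OF assms(1,2)] show ?thesis using assms by fastforce
  qed
next
  case False
  obtain t\<^sub>1 where t1: "t\<^sub>1 > 0" "x + t\<^sub>1 * a = 0 \<or> x + t\<^sub>1 * a = 1"
    "\<And>s. 0 \<le> s \<Longrightarrow> s \<le> t\<^sub>1 \<Longrightarrow> 0 \<le> x + s * a \<and> x + s * a \<le> 1"
    using exit_time1[OF assms(1,2)] False by blast
  obtain t\<^sub>2 where t2: "t\<^sub>2 > 0" "y + t\<^sub>2 * b = 0 \<or> y + t\<^sub>2 * b = 1"
    "\<And>s. 0 \<le> s \<Longrightarrow> s \<le> t\<^sub>2 \<Longrightarrow> 0 \<le> y + s * b \<and> y + s * b \<le> 1"
    using exit_time1[OF assms(3,4)] False by blast
  show ?thesis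
    using t1 t2 by (intro exI[of _ "min t\<^sub>1 t\<^sub>2"]) (auto simp: min_def)
qed

text \<open>An intermediate value argument: a weight that never equals \<open>Y\<close> cannot pass
  it.\<close>

lemma affine_crossing:
  fixes y d Y t :: real
  assumes "t \<ge> 0" "y > Y" "y + t * d \<le> Y"
  shows "\<exists>s. 0 \<le> s \<and> s \<le> t \<and> y + s * d = Y"
proof -
  have d: "d < 0" using assms by (smt (verit) mult_nonneg_nonneg)
  then have "(y - Y) / (- d) \<le> t" using assms by (subst pos_divide_le_eq) auto
  then show ?thesis using assms(2) d
    by (intro exI[of _ "(y - Y) / (- d)"]) (auto simp: field_simps)
qed

text \<open>Points move along segments on which neither excess decreases, so by \<open>barrier\<close> the total weight
  never leaves \<open>(Y\<^sub>1, Y\<^sub>2)\<close>.\<close>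

lemma round_pairs:
  fixes w :: "'a \<Rightarrow> 'a \<Rightarrow> real" and x :: "'a \<Rightarrow> real"
  assumes fin: "finite V" and sym: "\<And>u v. w u v = w v u" and irr: "\<And>u. w u u = 0"
    and x01: "\<And>v. v \<in> V \<Longrightarrow> 0 \<le> x v \<and> x v \<le> 1"
    and Y: "Y\<^sub>1 < sum x V" "sum x V < Y\<^sub>2"
    and barrier: "\<And>z. \<lbrakk>\<And>v. v \<in> V \<Longrightarrow> 0 \<le> z v \<and> z v \<le> 1; fractional V z \<subseteq> fractional V x;
      excess w V \<alpha> K x \<le> excess w V \<alpha> K z;
      excess w V \<beta> K (\<lambda>v. 1 - x v) \<le> excess w V \<beta> K (\<lambda>v. 1 - z v)\<rbrakk>
      \<Longrightarrow> sum z V \<noteq> Y\<^sub>1 \<and> sum z V \<noteq> Y\<^sub>2"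
  shows "\<exists>z. (\<forall>v\<in>V. 0 \<le> z v \<and> z v \<le> 1) \<and> fractional V z \<subseteq> fractional V x \<and>
    excess w V \<alpha> K x \<le> excess w V \<alpha> K z \<and>
    excess w V \<beta> K (\<lambda>v. 1 - x v) \<le> excess w V \<beta> K (\<lambda>v. 1 - z v) \<and>
    Y\<^sub>1 < sum z V \<and> sum z V < Y\<^sub>2 \<and>
    (\<forall>u\<in>fractional V z. \<forall>v\<in>fractional V z. u \<noteq> v \<longrightarrow> \<not> convex_pair w K u v)"
  using x01 Y barrier
proof (induction "card (fractional V x)" arbitrary: x rule: less_induct)
  case less
  show ?case
  proof (cases "\<forall>u\<in>fractional V x. \<forall>v\<in>fractional V x. u \<noteq> v \<longrightarrow> \<not> convex_pair w K u v")
    case True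
    with less.prems show ?thesis by (intro exI[of _ x]) auto
  next
    case False
    then obtain u v where uv: "u \<in> fractional V x" "v \<in> fractional V x" "u \<noteq> v" "convex_pair w K u v" by blast
    then have uvV: "u \<in> V" "v \<in> V" and xuv: "0 < x u" "x u < 1" "0 < x v" "x v < 1"
      by (auto simp: fractional_def)
    obtain p\<^sub>1 p\<^sub>2 where p: "\<forall>a b t. excess w V \<alpha> K (x(u := x u + t * a, v := x v + t * b)) =
        excess w V \<alpha> K x + t * (a * p\<^sub>1 + b * p\<^sub>2)
        + t\<^sup>2 * (2 * a * b * w u v + of_bool (u \<in> K) * a\<^sup>2 + of_bool (v \<in> K) * b\<^sup>2)"
      by (rule excess_line[where w = w and \<alpha> = \<alpha> and K = K and x = x, OF fin sym irr uvV uv(3)])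
    define x' where "x' = (\<lambda>v. 1 - x v)"
    obtain q\<^sub>1 q\<^sub>2 where q: "\<forall>a b t. excess w V \<beta> K (x'(u := x' u + t * a, v := x' v + t * b)) =
        excess w V \<beta> K x' + t * (a * q\<^sub>1 + b * q\<^sub>2)
        + t\<^sup>2 * (2 * a * b * w u v + of_bool (u \<in> K) * a\<^sup>2 + of_bool (v \<in> K) * b\<^sup>2)"
      by (rule excess_line[where w = w and \<alpha> = \<beta> and K = K and x = x', OF fin sym irr uvV uv(3)])
    \<comment> \<open>The complementary point moves by \<open>(-a, -b)\<close>, so its slopes enter
      with the opposite sign.\<close>
    obtain a b where ab: "a \<noteq> 0 \<or> b \<noteq> 0" "a * p\<^sub>1 + b * p\<^sub>2 \<ge> 0" "a * (- q\<^sub>1) + b * (- q\<^sub>2) \<ge> 0"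
      using exists_direction by metis
    obtain t where t: "t > 0" "x u + t * a \<in> {0, 1} \<or> x v + t * b \<in> {0, 1}"
      "\<And>s. 0 \<le> s \<Longrightarrow> s \<le> t \<Longrightarrow>
        0 \<le> x u + s * a \<and> x u + s * a \<le> 1 \<and> 0 \<le> x v + s * b \<and> x v + s * b \<le> 1"
      using exit_time[OF xuv ab(1)] by blast
    define X where "X s = x(u := x u + s * a, v := x v + s * b)" for s
    have conv: "2 * a * b * w u v + of_bool (u \<in> K) * a\<^sup>2 + of_bool (v \<in> K) * b\<^sup>2 \<ge> 0" for a b
      using uv(4) unfolding convex_pair_def by blast
    have ex1: "excess w V \<alpha> K x \<le> excess w V \<alpha> K (X s)" if "0 \<le> s" for s
      unfolding X_def p[rule_format] using that ab(2) conv[of a b] by (simp add: add_nonneg_nonneg)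
    have ex2: "excess w V \<beta> K (\<lambda>v. 1 - x v) \<le> excess w V \<beta> K (\<lambda>v. 1 - X s v)" if "0 \<le> s" for s
    proof -
      have "(\<lambda>v. 1 - X s v) = x'(u := x' u + s * (- a), v := x' v + s * (- b))"
        by (auto simp: X_def x'_def fun_eq_iff)
      then have "excess w V \<beta> K (\<lambda>v. 1 - X s v) = excess w V \<beta> K x' + s * ((- a) * q\<^sub>1 + (- b) * q\<^sub>2)
        + s\<^sup>2 * (2 * (- a) * (- b) * w u v + of_bool (u \<in> K) * (- a)\<^sup>2 + of_bool (v \<in> K) * (- b)\<^sup>2)"
        by (simp only: q[rule_format])
      moreover have "s * ((- a) * q\<^sub>1 + (- b) * q\<^sub>2) \<ge> 0"
        using that ab(3) by (intro mult_nonneg_nonneg) auto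
      moreover have "s\<^sup>2 * (2 * (- a) * (- b) * w u v + of_bool (u \<in> K) * (- a)\<^sup>2 + of_bool (v \<in> K) * (- b)\<^sup>2) \<ge> 0"
        by (intro mult_nonneg_nonneg conv) simp
      ultimately show ?thesis unfolding x'_def[symmetric] by linarith
    qed
    have X01: "0 \<le> X s z \<and> X s z \<le> 1" if "0 \<le> s" "s \<le> t" "z \<in> V" for s z
      using t(3)[OF that(1,2)] less.prems(1)[OF that(3)] by (auto simp: X_def)
    have Xfrac: "fractional V (X s) \<subseteq> fractional V x" for s
      using uv(1,2) by (auto simp: X_def fractional_def split: if_splits)
    have sumX: "sum (X s) V = sum x V + s * (a + b)" for s
    proof -
      have "X s = (\<lambda>z. x z + s * (if z = u then a else if z = v then b else 0))"
        using uv(3) by (auto simp: X_def fun_eq_iff)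
      then show ?thesis
        using sum_two_points[OF fin uvV uv(3), of "\<lambda>_. 1" a b]
        by (simp add: sum.distrib sum_distrib_left[symmetric])
    qed
    have noY: "sum (X s) V \<noteq> Y\<^sub>1 \<and> sum (X s) V \<noteq> Y\<^sub>2" if "0 \<le> s" "s \<le> t" for s
      using less.prems(4)[of "X s"] X01[OF that] Xfrac ex1[OF that(1)] ex2[OF that(1)] by blast
    have Y1: "Y\<^sub>1 < sum (X t) V"
      using affine_crossing[of t Y\<^sub>1 "sum x V" "a + b"] noY sumX t(1) less.prems(2)
      by (metis less_eq_real_def not_le)
    \<comment> \<open>Negation turns the upper barrier into a lower one.\<close>
    have Y2: "sum (X t) V < Y\<^sub>2"
    proof (rule ccontr)
      assume "\<not> sum (X t) V < Y\<^sub>2"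
      then have "- sum x V + t * (- (a + b)) \<le> - Y\<^sub>2" unfolding sumX by (simp add: algebra_simps)
      then obtain s where "0 \<le> s" "s \<le> t" "- sum x V + s * (- (a + b)) = - Y\<^sub>2"
        using affine_crossing[of t "- Y\<^sub>2" "- sum x V" "- (a + b)"] t(1) less.prems(3) by auto
      then show False using noY[of s] unfolding sumX by (simp add: algebra_simps)
    qed
    \<comment> \<open>At the exit time one of the two vertices has become integral, so the induction
      measure drops.\<close>
    have "u \<notin> fractional V (X t) \<or> v \<notin> fractional V (X t)"
      using t(2) uv(3) by (auto simp: fractional_def X_def)
    then have "fractional V (X t) \<subset> fractional V x" using Xfrac uv(1,2) by blast
    then have "card (fractional V (X t)) < card (fractional V x)"
      by (intro psubset_card_mono) (use fin in \<open>auto simp: fractional_def\<close>)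
    then obtain z where z: "\<forall>v\<in>V. 0 \<le> z v \<and> z v \<le> 1" "fractional V z \<subseteq> fractional V (X t)"
      "excess w V \<alpha> K (X t) \<le> excess w V \<alpha> K z"
      "excess w V \<beta> K (\<lambda>v. 1 - X t v) \<le> excess w V \<beta> K (\<lambda>v. 1 - z v)"
      "Y\<^sub>1 < sum z V" "sum z V < Y\<^sub>2"
      "\<forall>u\<in>fractional V z. \<forall>v\<in>fractional V z. u \<noteq> v \<longrightarrow> \<not> convex_pair w K u v"
    proof -
      have "sum z V \<noteq> Y\<^sub>1 \<and> sum z V \<noteq> Y\<^sub>2" if "\<And>v. v \<in> V \<Longrightarrow> 0 \<le> z v \<and> z v \<le> 1"
        "fractional V z \<subseteq> fractional V (X t)" "excess w V \<alpha> K (X t) \<le> excess w V \<alpha> K z"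
        "excess w V \<beta> K (\<lambda>v. 1 - X t v) \<le> excess w V \<beta> K (\<lambda>v. 1 - z v)" for z
        using less.prems(4)[of z] that Xfrac[of t] ex1[of t] ex2[of t] t(1) by (meson less_imp_le order_trans)
      from less.hyps[OF \<open>card _ < card _\<close> X01 Y1 Y2 this] that t(1) show ?thesis by (auto simp: less_imp_le)
    qed
    then show ?thesis using Xfrac[of t] ex1[of t] ex2[of t] t(1)
      by (intro exI[of _ z]) (auto intro: order_trans)
  qed
qed

section \<open>Decomposition into two dense parts\<close>

lemma vol_insert:
  assumes "finite A" "u \<notin> A" "\<And>u v. w u v = w v u" "w u u = 0"
  shows "vol w (insert u A) = vol w A + 2 * (\<Sum>v\<in>A. w u v)"
proof -
  have "(\<Sum>v\<in>A. w v u) = (\<Sum>v\<in>A. w u v)" by (simp add: assms(3)[of u])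
  then show ?thesis using assms by (simp add: vol_def sum.distrib)
qed

section \<open>Bounds for the excess\<close>

text \<open>The graph is compared with the complete graph on \<open>V\<close>, whose quadratic form
  is the square of the sum minus the sum of squares.\<close>

lemma excess_le:
  fixes w :: "'a \<Rightarrow> 'a \<Rightarrow> real" and x :: "'a \<Rightarrow> real"
  assumes "finite V" and w: "\<And>u v. w u v \<in> {0, 1}" and irr: "\<And>u. w u u = 0"
    and x01: "\<And>v. v \<in> V \<Longrightarrow> 0 \<le> x v \<and> x v \<le> 1"
  shows "excess w V \<alpha> K x \<le> (sum x V)\<^sup>2 - 2 * \<alpha> * sum x V - (\<Sum>v\<in>V. (x v)\<^sup>2)
    - (\<Sum>v\<in>V. of_bool (v \<in> K) * (x v * (1 - x v)))"
proof -
  have "quad w V x \<le> (\<Sum>u\<in>V. \<Sum>v\<in>V. x u * x v - (if u = v then (x u)\<^sup>2 else 0))"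
    unfolding quad_def
  proof (intro sum_mono)
    fix u v assume "u \<in> V" "v \<in> V"
    then show "w u v * x u * x v \<le> x u * x v - (if u = v then (x u)\<^sup>2 else 0)"
      using w[of u v] irr[of u] x01 by (auto simp: power2_eq_square)
  qed
  also have "\<dots> = (sum x V)\<^sup>2 - (\<Sum>v\<in>V. (x v)\<^sup>2)"
    using assms(1) by (simp add: sum_subtractf sum_product power2_eq_square)
  finally show ?thesis by (simp add: excess_def)
qed

lemma excess_le':
  fixes w :: "'a \<Rightarrow> 'a \<Rightarrow> real" and x :: "'a \<Rightarrow> real"
  assumes "finite V" and w: "\<And>u v. w u v \<in> {0, 1}" and irr: "\<And>u. w u u = 0"
    and x01: "\<And>v. v \<in> V \<Longrightarrow> 0 \<le> x v \<and> x v \<le> 1"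
  shows "excess w V \<alpha> K x \<le> (sum x V)\<^sup>2 - 2 * \<alpha> * sum x V"
proof -
  have "(\<Sum>v\<in>V. (x v)\<^sup>2) \<ge> 0" "(\<Sum>v\<in>V. of_bool (v \<in> K) * (x v * (1 - x v))) \<ge> 0"
    using x01 by (auto intro!: sum_nonneg)
  with excess_le[where w = w and x = x and \<alpha> = \<alpha> and K = K, OF assms] show ?thesis by linarith
qed

text \<open>Outside \<open>K\<close> the entries are integral and equal their squares; inside
  \<open>K\<close> the penalty supplies \<open>x v - (x v)\<^sup>2\<close>. The two sums subtracted
  in \<open>excess_le\<close> thus add up to \<open>sum x V\<close>.\<close>

lemma excess_le_fractional:
  fixes w :: "'a \<Rightarrow> 'a \<Rightarrow> real" and x :: "'a \<Rightarrow> real"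
  assumes "finite V" and w: "\<And>u v. w u v \<in> {0, 1}" and irr: "\<And>u. w u u = 0"
    and x01: "\<And>v. v \<in> V \<Longrightarrow> 0 \<le> x v \<and> x v \<le> 1" and "fractional V x \<subseteq> K"
  shows "excess w V \<alpha> K x \<le> (sum x V)\<^sup>2 - (2 * \<alpha> + 1) * sum x V"
proof -
  have "sum x V = (\<Sum>v\<in>V. (x v)\<^sup>2 + of_bool (v \<in> K) * (x v * (1 - x v)))"
  proof (rule sum.cong)
    fix v assume v: "v \<in> V"
    show "x v = (x v)\<^sup>2 + of_bool (v \<in> K) * (x v * (1 - x v))"
    proof (cases "v \<in> K")
      case False
      then have "x v = 0 \<or> x v = 1" using v x01[OF v] assms(5) by (force simp: fractional_def)
      then show ?thesis using False by auto
    qed (simp add: algebra_simps power2_eq_square)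
  qed simp
  then have "sum x V = (\<Sum>v\<in>V. (x v)\<^sup>2) + (\<Sum>v\<in>V. of_bool (v \<in> K) * (x v * (1 - x v)))"
    by (simp only: sum.distrib)
  with excess_le[where w = w and x = x and \<alpha> = \<alpha> and K = K, OF assms(1-4)] show ?thesis
    unfolding distrib_right by linarith
qed

text \<open>Each penalty term is at most 1/4, by completing the square.\<close>

lemma excess_ge_clique:
  fixes w :: "'a \<Rightarrow> 'a \<Rightarrow> real" and x :: "'a \<Rightarrow> real"
  assumes "finite V" "K \<subseteq> V"
  shows "excess w V \<alpha> K x \<ge> excess w V \<alpha> {} x - card K / 4"
proof -
  have *: "x v * (1 - x v) \<le> 1 / 4" for v
    using zero_le_power2[of "x v - 1 / 2"] by (simp add: power2_eq_square algebra_simps)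
  have "(\<Sum>v\<in>V. of_bool (v \<in> K) * (x v * (1 - x v))) = (\<Sum>v\<in>K. x v * (1 - x v))"
    using assms by (intro sum.mono_neutral_cong_right) auto
  also have "\<dots> \<le> (\<Sum>v\<in>K. 1 / 4)" by (intro sum_mono *)
  finally show ?thesis by (simp add: excess_def)
qed

text \<open>Only \<open>A\<close> and \<open>u\<close> carry weight, and the penalty can only lower
  the excess. The vertex \<open>u\<close> is set aside even if its own value is integral.\<close>

lemma excess_le_integral_part:
  fixes w :: "'a \<Rightarrow> 'a \<Rightarrow> real" and x :: "'a \<Rightarrow> real"
  assumes "finite V" and sym: "\<And>u v. w u v = w v u" and irr: "\<And>u. w u u = 0"
    and x01: "\<And>v. v \<in> V \<Longrightarrow> 0 \<le> x v \<and> x v \<le> 1"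
    and u: "u \<in> V" and fractional: "fractional V x \<subseteq> {u}"
    and A: "A = {v \<in> V - {u}. x v = 1}"
  shows "excess w V \<alpha> K x \<le> vol w A + 2 * x u * (\<Sum>v\<in>A. w u v) - 2 * \<alpha> * (card A + x u)"
    and "sum x V = card A + x u"
proof -
  have fA: "finite A" "u \<notin> A" "insert u A \<subseteq> V" using assms(1) u by (auto simp: A)
  have out: "x v = 0" if "v \<in> V - insert u A" for v
    using that fractional x01[of v] by (force simp: A fractional_def)
  have one: "x v = 1" if "v \<in> A" for v using that by (simp add: A)
  have "quad w V x = (\<Sum>u'\<in>insert u A. \<Sum>v\<in>V. w u' v * x u' * x v)"
    unfolding quad_def using fA(3) assms(1) out by (intro sum.mono_neutral_right) auto
  also have "\<dots> = (\<Sum>u'\<in>insert u A. \<Sum>v\<in>insert u A. w u' v * x u' * x v)"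
    using fA(3) assms(1) out by (intro sum.cong refl sum.mono_neutral_right) auto
  also have "\<dots> = vol w A + 2 * x u * (\<Sum>v\<in>A. w u v)"
    using fA(1,2) by (simp add: one irr sym[of _ u] vol_def sum.distrib sum_distrib_left mult_ac)
  finally have q: "quad w V x = vol w A + 2 * x u * (\<Sum>v\<in>A. w u v)" .
  have "sum x V = sum x (insert u A)"
    using fA(3) assms(1) out by (intro sum.mono_neutral_right) auto
  also have "\<dots> = card A + x u" using fA(1,2) by (simp add: one)
  finally show s: "sum x V = card A + x u" .
  have "(\<Sum>v\<in>V. of_bool (v \<in> K) * (x v * (1 - x v))) \<ge> 0" using x01 by (auto intro!: sum_nonneg)
  then show "excess w V \<alpha> K x \<le> vol w A + 2 * x u * (\<Sum>v\<in>A. w u v) - 2 * \<alpha> * (card A + x u)"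
    by (simp add: excess_def q s)
qed

text \<open>Here \<open>a\<close> is the size of one side, \<open>vA\<close> twice its number of edges, \<open>\<xi>\<close> its share of the last fractional
  vertex, and \<open>d\<close> the number of neighbours of that vertex on this side. The side with a small share
  drops the vertex; the other side then is free to take it or not.\<close>

lemma drop_small_share:
  fixes vA d a \<alpha> q \<xi> :: real
  assumes "vA + 2 * \<xi> * d - 2 * \<alpha> * (a + \<xi>) \<ge> - 2 * \<alpha> * q"
    and "d \<le> a" "0 \<le> \<xi>" "\<xi> \<le> q" "q \<le> 1" "a + \<xi> > \<alpha> + 1"
  shows "vA \<ge> 2 * (\<alpha> - q) * a"
proof -
  have "\<xi> * d \<le> \<xi> * a" using assms by (intro mult_left_mono)
  moreover have "(q - \<xi>) * (a - \<alpha>) \<ge> 0" using assms by (intro mult_nonneg_nonneg) auto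
  ultimately show ?thesis using assms(1) by (simp add: algebra_simps)
qed

text \<open>The surplus over the target density \<open>\<alpha> - q\<close> is affine in the share.
  It is nonnegative at \<open>\<xi>\<close>, being at least
  \<open>2 * q * (a + \<xi> - \<alpha>)\<close>, hence nonnegative at share 0 or at share 1.\<close>

lemma take_or_drop:
  fixes vA d a \<alpha> q \<xi> :: real
  assumes "vA + 2 * \<xi> * d - 2 * \<alpha> * (a + \<xi>) \<ge> - 2 * \<alpha> * q"
    and "0 \<le> \<xi>" "\<xi> \<le> 1" "0 < q" "a + \<xi> > \<alpha> + 1"
  shows "vA \<ge> 2 * (\<alpha> - q) * a \<or> vA + 2 * d \<ge> 2 * (\<alpha> - q) * (a + 1)"
proof (cases "d \<ge> \<alpha> - q")
  case True
  then have "(1 - \<xi>) * (d - (\<alpha> - q)) \<ge> 0" using assms by (intro mult_nonneg_nonneg) auto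
  moreover have "q * (a + \<xi> - \<alpha>) \<ge> 0" using assms by (intro mult_nonneg_nonneg) auto
  ultimately have "vA + 2 * d \<ge> 2 * (\<alpha> - q) * (a + 1)" using assms(1) by (simp add: algebra_simps)
  then show ?thesis ..
next
  case False
  then have "\<xi> * (\<alpha> - q - d) \<ge> 0" using assms by (intro mult_nonneg_nonneg) auto
  moreover have "q * (a + \<xi> - \<alpha>) \<ge> 0" using assms by (intro mult_nonneg_nonneg) auto
  ultimately have "vA \<ge> 2 * (\<alpha> - q) * a" using assms(1) by (simp add: algebra_simps)
  then show ?thesis ..
qed

text \<open>The lower bounds on \<open>p * c\<close> and \<open>(1 - p) * c\<close> serve the
  barriers, the clique bound pays for the penalty. The factors 2 are there because
  \<open>vol\<close> counts every edge twice.\<close>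

theorem dense_decomposition:
  fixes w :: "'a \<Rightarrow> 'a \<Rightarrow> real" and c p :: real
  assumes fin: "finite V" and ne: "V \<noteq> {}"
    and sym: "\<And>u v. w u v = w v u" and irr: "\<And>u. w u u = 0" and w01: "\<And>u v. w u v \<in> {0, 1}"
    and dense: "vol w V \<ge> 2 * c * card V"
    and p: "0 < p" "p < 1" "p * c > 1" "(1 - p) * c > 1"
    and cliques: "\<And>K. \<lbrakk>K \<subseteq> V; \<And>u v. \<lbrakk>u \<in> K; v \<in> K; u \<noteq> v\<rbrakk> \<Longrightarrow> w u v = 1\<rbrakk> \<Longrightarrow> card K \<le> 8 * p * (1 - p) * c"
  shows "\<exists>A B. A \<subseteq> V \<and> B \<subseteq> V \<and> A \<inter> B = {} \<and> A \<noteq> {} \<and> B \<noteq> {} \<and>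
    vol w A \<ge> 2 * (p * c - (1 - p)) * card A \<and> vol w B \<ge> 2 * ((1 - p) * c - p) * card B"
proof -
  define \<alpha> \<beta> n where "\<alpha> = p * c" and "\<beta> = (1 - p) * c" and "n = real (card V)"
  have \<alpha>\<beta>: "\<alpha> > 1" "\<beta> > 1" using p by (auto simp: \<alpha>_def \<beta>_def)
  have n: "n > 0" using fin ne by (simp add: n_def card_gt_0_iff)
  \<comment> \<open>These are the total weights at which the first side weighs
    \<open>\<alpha> + 1\<close> and the second \<open>\<beta> + 1\<close>.\<close>
  define Y\<^sub>1 Y\<^sub>2 where "Y\<^sub>1 = \<alpha> + 1" and "Y\<^sub>2 = n - (\<beta> + 1)"
  have sum_compl: "(\<Sum>v\<in>V. 1 - z v) = n - sum z V" for z :: "'a \<Rightarrow> real"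
    by (simp add: sum_subtractf n_def)
  have fc: "fractional V (\<lambda>v. 1 - z v) = fractional V z" for z by (auto simp: fractional_def)
  note le = excess_le'[where w = w, OF fin w01 irr] and lefrac = excess_le_fractional[where w = w, OF fin w01 irr]

  define x\<^sub>0 where "x\<^sub>0 = (\<lambda>_::'a. p)"
  have const: "quad w V (\<lambda>_. y) = y\<^sup>2 * vol w V" for y
    by (simp add: quad_def vol_def sum_distrib_left power2_eq_square mult_ac)
  \<comment> \<open>A graph is no denser than the complete one, so \<open>2 * c\<close> is at most
    \<open>n - 1\<close>; this puts the initial weight \<open>p * n\<close> strictly between the
    barriers.\<close>
  have "vol w V \<le> n\<^sup>2 - n"
    using lefrac[where x = "\<lambda>_. 1" and K = "{}" and \<alpha> = 0] const[of 1] by (simp add: excess_def fractional_def n_def)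
  with dense have "n * (2 * c) \<le> n * (n - 1)" by (simp add: n_def algebra_simps power2_eq_square)
  with n have nc: "2 * c \<le> n - 1" by (simp only: mult_le_cancel_left_pos)
  have "p * (2 * c) \<le> p * (n - 1)" "(1 - p) * (2 * c) \<le> (1 - p) * (n - 1)"
    using nc p by (intro mult_left_mono; simp)+
  then have Y0: "Y\<^sub>1 < sum x\<^sub>0 V" "sum x\<^sub>0 V < Y\<^sub>2"
    using p by (auto simp: x\<^sub>0_def Y\<^sub>1_def Y\<^sub>2_def \<alpha>_def \<beta>_def n_def algebra_simps)
  have e0: "0 \<le> excess w V \<alpha> {} x\<^sub>0" "0 \<le> excess w V \<beta> {} (\<lambda>v. 1 - x\<^sub>0 v)"
  proof -
    have "excess w V \<alpha> {} x\<^sub>0 = p\<^sup>2 * (vol w V - 2 * c * card V)"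
      "excess w V \<beta> {} (\<lambda>v. 1 - x\<^sub>0 v) = (1 - p)\<^sup>2 * (vol w V - 2 * c * card V)"
      unfolding excess_def x\<^sub>0_def const by (auto simp: \<alpha>_def \<beta>_def algebra_simps power2_eq_square)
    then show "0 \<le> excess w V \<alpha> {} x\<^sub>0" "0 \<le> excess w V \<beta> {} (\<lambda>v. 1 - x\<^sub>0 v)" using dense by simp_all
  qed
  text \<open>A set of total weight \<open>\<gamma> + 1\<close> is too small to have density \<open>\<gamma>\<close>. This keeps the weights of both
    sides from shrinking to \<open>0\<close>, where the excess conditions would be void.\<close>
  have gap: "\<not> 0 \<le> (\<gamma> + 1)\<^sup>2 - 2 * \<gamma> * (\<gamma> + 1)" if "\<gamma> > 1" for \<gamma> :: real
  proof -
    have "(\<gamma> + 1) * (1 - \<gamma>) < 0" using that by (intro mult_pos_neg) auto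
    then show ?thesis by (simp add: algebra_simps power2_eq_square)
  qed
  \<comment> \<open>First phase, without penalty: only nonadjacent vertices form convex pairs, so
    the vertices left fractional form a clique.\<close>
  obtain x where x: "\<And>v. v \<in> V \<Longrightarrow> 0 \<le> x v \<and> x v \<le> 1"
    "0 \<le> excess w V \<alpha> {} x" "0 \<le> excess w V \<beta> {} (\<lambda>v. 1 - x v)"
    "Y\<^sub>1 < sum x V" "sum x V < Y\<^sub>2"
    "\<And>u v. u \<in> fractional V x \<Longrightarrow> v \<in> fractional V x \<Longrightarrow> u \<noteq> v \<Longrightarrow> \<not> convex_pair w {} u v"
  proof -
    have "sum z V \<noteq> Y\<^sub>1 \<and> sum z V \<noteq> Y\<^sub>2" if "\<And>v. v \<in> V \<Longrightarrow> 0 \<le> z v \<and> z v \<le> 1"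
      "excess w V \<alpha> {} x\<^sub>0 \<le> excess w V \<alpha> {} z"
      "excess w V \<beta> {} (\<lambda>v. 1 - x\<^sub>0 v) \<le> excess w V \<beta> {} (\<lambda>v. 1 - z v)" for z
    proof -
      have "0 \<le> (sum z V)\<^sup>2 - 2 * \<alpha> * sum z V" using le[where x = z and \<alpha> = \<alpha> and K = "{}"] that e0 by fastforce
      moreover have "0 \<le> (n - sum z V)\<^sup>2 - 2 * \<beta> * (n - sum z V)"
        using le[where x = "\<lambda>v. 1 - z v" and \<alpha> = \<beta> and K = "{}"] that e0 unfolding sum_compl by fastforce
      ultimately show ?thesis using gap[OF \<alpha>\<beta>(1)] gap[OF \<alpha>\<beta>(2)] by (auto simp: Y\<^sub>1_def Y\<^sub>2_def)
    qed
    then obtain z where "\<forall>v\<in>V. 0 \<le> z v \<and> z v \<le> 1"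
      "excess w V \<alpha> {} x\<^sub>0 \<le> excess w V \<alpha> {} z"
      "excess w V \<beta> {} (\<lambda>v. 1 - x\<^sub>0 v) \<le> excess w V \<beta> {} (\<lambda>v. 1 - z v)"
      "Y\<^sub>1 < sum z V" "sum z V < Y\<^sub>2"
      "\<forall>u\<in>fractional V z. \<forall>v\<in>fractional V z. u \<noteq> v \<longrightarrow> \<not> convex_pair w {} u v"
      using round_pairs[where w = w and x = x\<^sub>0 and Y\<^sub>1 = Y\<^sub>1 and Y\<^sub>2 = Y\<^sub>2 and \<alpha> = \<alpha> and \<beta> = \<beta> and K = "{}", OF fin sym irr] Y0 p by (auto simp: x\<^sub>0_def)
    then show thesis using that[of z] e0 by fastforce
  qed

  define K where "K = fractional V x"
  have KV: "K \<subseteq> V" by (auto simp: K_def fractional_def)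
  have clique: "w u v = 1" if "u \<in> K" "v \<in> K" "u \<noteq> v" for u v
    using x(6)[of u v] that w01[of u v] by (auto simp: K_def convex_pair_def)
  have cK: "card K \<le> 8 * p * (1 - p) * c" by (intro cliques KV clique)
  \<comment> \<open>The clique bound makes the penalty at most \<open>\<kappa>\<close>, which equals
    both \<open>2 * \<alpha> * (1 - p)\<close> and \<open>2 * \<beta> * p\<close>, so one deficit
    serves both sides.\<close>
  define \<kappa> where "\<kappa> = 2 * p * (1 - p) * c"
  have e1: "excess w V \<alpha> K x \<ge> - \<kappa>" "excess w V \<beta> K (\<lambda>v. 1 - x v) \<ge> - \<kappa>"
    using excess_ge_clique[OF fin KV, of w \<alpha> x] excess_ge_clique[OF fin KV, of w \<beta> "\<lambda>v. 1 - x v"] x(2,3) cK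
    by (auto simp: \<kappa>_def)
  have \<kappa>: "\<kappa> = 2 * \<alpha> * (1 - p)" "\<kappa> = 2 * \<beta> * p" by (auto simp: \<kappa>_def \<alpha>_def \<beta>_def)
  \<comment> \<open>In the second phase the excess may be as low as \<open>-\<kappa>\<close>. The
    fractional vertices stay in \<open>K\<close>, and the sharper bound of
    \<open>excess_le_fractional\<close> still rules out the weight
    \<open>\<gamma> + 1\<close>.\<close>
  have gap: "\<not> - (2 * \<gamma> * q) \<le> (\<gamma> + 1)\<^sup>2 - (2 * \<gamma> + 1) * (\<gamma> + 1)" if "\<gamma> > 1" "q < 1" for \<gamma> q :: real
  proof -
    have "\<gamma> * (\<gamma> + 1 - 2 * q) > 0" using that by (intro mult_pos_pos) auto
    then show ?thesis by (simp add: algebra_simps power2_eq_square)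
  qed
  obtain z where z: "\<And>v. v \<in> V \<Longrightarrow> 0 \<le> z v \<and> z v \<le> 1"
    "- \<kappa> \<le> excess w V \<alpha> K z" "- \<kappa> \<le> excess w V \<beta> K (\<lambda>v. 1 - z v)"
    "Y\<^sub>1 < sum z V" "sum z V < Y\<^sub>2"
    "\<And>u v. u \<in> fractional V z \<Longrightarrow> v \<in> fractional V z \<Longrightarrow> u = v"
  proof -
    have "sum z V \<noteq> Y\<^sub>1 \<and> sum z V \<noteq> Y\<^sub>2" if "\<And>v. v \<in> V \<Longrightarrow> 0 \<le> z v \<and> z v \<le> 1" "fractional V z \<subseteq> fractional V x"
      "excess w V \<alpha> K x \<le> excess w V \<alpha> K z"
      "excess w V \<beta> K (\<lambda>v. 1 - x v) \<le> excess w V \<beta> K (\<lambda>v. 1 - z v)" for z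
    proof -
      have "- \<kappa> \<le> (sum z V)\<^sup>2 - (2 * \<alpha> + 1) * sum z V"
        using lefrac[where x = z and K = K and \<alpha> = \<alpha>] that e1 by (fastforce simp: K_def)
      moreover have "- \<kappa> \<le> (n - sum z V)\<^sup>2 - (2 * \<beta> + 1) * (n - sum z V)"
        using lefrac[where x = "\<lambda>v. 1 - z v" and K = K and \<alpha> = \<beta>] that e1 unfolding sum_compl fc by (fastforce simp: K_def)
      ultimately show ?thesis using gap[OF \<alpha>\<beta>(1), of "1 - p"] gap[OF \<alpha>\<beta>(2), of p] p
        unfolding \<kappa>[symmetric] by (auto simp: Y\<^sub>1_def Y\<^sub>2_def simp flip: \<kappa>)
    qed
    then obtain z where z: "\<forall>v\<in>V. 0 \<le> z v \<and> z v \<le> 1" "fractional V z \<subseteq> fractional V x"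
      "excess w V \<alpha> K x \<le> excess w V \<alpha> K z"
      "excess w V \<beta> K (\<lambda>v. 1 - x v) \<le> excess w V \<beta> K (\<lambda>v. 1 - z v)"
      "Y\<^sub>1 < sum z V" "sum z V < Y\<^sub>2"
      "\<forall>u\<in>fractional V z. \<forall>v\<in>fractional V z. u \<noteq> v \<longrightarrow> \<not> convex_pair w K u v"
      using round_pairs[where w = w and x = x and \<alpha> = \<alpha> and \<beta> = \<beta> and K = K, OF fin sym irr x(1) x(4,5)] by auto
    \<comment> \<open>For two vertices of the clique the form is \<open>(a + b)\<^sup>2\<close>, so
      no two of them can remain fractional.\<close>
    have "convex_pair w K u v" if "u \<in> K" "v \<in> K" "u \<noteq> v" for u v
      using clique[OF that] that zero_le_power2[of "_ + _ :: real"]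
      by (auto simp: convex_pair_def power2_sum add_ac mult_ac)
    with z(2,7) have "u = v" if "u \<in> fractional V z" "v \<in> fractional V z" for u v
      using that unfolding K_def by blast
    then show thesis using z e1 that[of z] by fastforce
  qed

  \<comment> \<open>If every vertex is already integral, any vertex serves as the last one.\<close>
  obtain u where u: "u \<in> V" "fractional V z \<subseteq> {u}"
  proof (cases "fractional V z = {}")
    case True
    with ne that show thesis by auto
  next
    case False
    then obtain u where "u \<in> fractional V z" by auto
    with z(6) show thesis by (intro that[of u]) (auto simp: fractional_def)
  qed
  define \<xi> A B where "\<xi> = z u" and "A = {v \<in> V - {u}. z v = 1}" and "B = {v \<in> V - {u}. z v = 0}"
  have AB: "finite A" "finite B" "u \<notin> A" "u \<notin> B" "A \<inter> B = {}" "A \<subseteq> V" "B \<subseteq> V" and \<xi>: "0 \<le> \<xi>" "\<xi> \<le> 1"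
    using fin z(1)[OF u(1)] by (auto simp: A_def B_def \<xi>_def)
  define dA dB where "dA = (\<Sum>v\<in>A. w u v)" and "dB = (\<Sum>v\<in>B. w u v)"
  have "w u v \<le> 1" for v using w01[of u v] by auto
  then have d: "dA \<le> card A" "dB \<le> card B"
    using sum_bounded_above[of A "w u" 1] sum_bounded_above[of B "w u" 1]
    by (auto simp: dA_def dB_def)
  have B': "B = {v \<in> V - {u}. 1 - z v = 1}" by (auto simp: B_def)
  have hA: "vol w A + 2 * \<xi> * dA - 2 * \<alpha> * (card A + \<xi>) \<ge> - 2 * \<alpha> * (1 - p)" "card A + \<xi> > \<alpha> + 1"
    using excess_le_integral_part(1)[where w = w and \<alpha> = \<alpha> and K = K, OF fin sym irr z(1) u A_def]
      excess_le_integral_part(2)[where w = w, OF fin sym irr z(1) u A_def] z(2,4) \<kappa>(1)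
    by (auto simp: dA_def \<xi>_def Y\<^sub>1_def)
  have z': "0 \<le> 1 - z v \<and> 1 - z v \<le> 1" if "v \<in> V" for v using z(1)[OF that] by simp
  have hB: "vol w B + 2 * (1 - \<xi>) * dB - 2 * \<beta> * (card B + (1 - \<xi>)) \<ge> - 2 * \<beta> * p"
    "card B + (1 - \<xi>) > \<beta> + 1"
    using excess_le_integral_part(1)[where w = w and \<alpha> = \<beta> and K = K and x = "\<lambda>v. 1 - z v",
        OF fin sym irr z' u[folded fc[of z]] B']
      excess_le_integral_part(2)[where w = w and x = "\<lambda>v. 1 - z v", OF fin sym irr z' u[folded fc[of z]] B']
      z(3,5) \<kappa>(2)
    unfolding sum_compl by (auto simp: dB_def \<xi>_def Y\<^sub>2_def)
  have ABne: "A \<noteq> {}" "B \<noteq> {}" using hA(2) hB(2) \<xi> \<alpha>\<beta> by auto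
  have ins: "vol w (insert u A) = vol w A + 2 * dA" "vol w (insert u B) = vol w B + 2 * dB"
    using vol_insert[where w = w, OF AB(1,3) sym irr] vol_insert[where w = w, OF AB(2,4) sym irr]
    by (simp_all add: dA_def dB_def)
  have cins: "real (card (insert u A)) = real (card A) + 1" "real (card (insert u B)) = real (card B) + 1"
    using AB by simp_all
  show ?thesis
  \<comment> \<open>The thresholds \<open>1 - p\<close> and \<open>p\<close> add up to 1, as do the
    shares \<open>\<xi>\<close> and \<open>1 - \<xi>\<close>, so one side always has a small
    share.\<close>
  proof (cases "\<xi> \<le> 1 - p")
    case True
    have "vol w A \<ge> 2 * (\<alpha> - (1 - p)) * card A"
      using drop_small_share[OF hA(1) d(1) \<xi>(1) True _ hA(2)] p by simp
    moreover have "vol w B \<ge> 2 * (\<beta> - p) * card B \<or>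
        vol w (insert u B) \<ge> 2 * (\<beta> - p) * card (insert u B)"
      unfolding ins cins by (rule take_or_drop[OF hB(1) _ _ p(1) hB(2)]) (use \<xi> p in simp_all)
    moreover from this obtain B' where "B' \<in> {B, insert u B}" "vol w B' \<ge> 2 * (\<beta> - p) * card B'"
      by blast
    moreover from this have "B' \<subseteq> V" "A \<inter> B' = {}" "B' \<noteq> {}" using AB ABne u(1) by blast+
    ultimately show ?thesis using AB(6) ABne(1) unfolding \<alpha>_def \<beta>_def by blast
  next
    case False
    have "vol w B \<ge> 2 * (\<beta> - p) * card B"
      using drop_small_share[OF hB(1) d(2) _ _ _ hB(2)] p \<xi> False by simp
    moreover have "vol w A \<ge> 2 * (\<alpha> - (1 - p)) * card A \<or>
        vol w (insert u A) \<ge> 2 * (\<alpha> - (1 - p)) * card (insert u A)"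
      unfolding ins cins by (rule take_or_drop[OF hA(1) \<xi> _ hA(2)]) (use \<xi> p in simp_all)
    moreover from this obtain A' where "A' \<in> {A, insert u A}" "vol w A' \<ge> 2 * (\<alpha> - (1 - p)) * card A'"
      by blast
    moreover from this have "A' \<subseteq> V" "A' \<inter> B = {}" "A' \<noteq> {}" using AB ABne u(1) by blast+
    ultimately show ?thesis using AB(7) ABne(2) unfolding \<alpha>_def \<beta>_def by blast
  qed
qed

section \<open>Long cycles in dense graphs\<close>

text \<open>Pairing with the rotation joins the last vertex to the first. The empty list and the two
  ends of an edge also qualify, so uses come with a bound on the length.\<close>

definition is_cycle :: "'a rel \<Rightarrow> 'a list \<Rightarrow> bool" where
  "is_cycle E xs \<longleftrightarrow> distinct xs \<and> set (zip xs (rotate1 xs)) \<subseteq> E"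

abbreviation adjw :: "'a rel \<Rightarrow> 'a \<Rightarrow> 'a \<Rightarrow> real" where
  "adjw E \<equiv> \<lambda>u v. of_bool ((u, v) \<in> E)"

lemma zip_successively:
  assumes "successively R (x # ys)" "R (last (x # ys)) z"
  shows "\<forall>(a, b) \<in> set (zip (x # ys) (ys @ [z])). R a b"
  using assms by (induction ys arbitrary: x) auto

lemma is_cycle_path:
  assumes "distinct xs" "xs \<noteq> []" "successively (\<lambda>u v. (u, v) \<in> E) xs" "(last xs, hd xs) \<in> E"
  shows "is_cycle E xs"
proof (cases xs)
  case (Cons x ys)
  then show ?thesis
    using assms zip_successively[of "\<lambda>u v. (u, v) \<in> E" x ys x] by (auto simp: is_cycle_def)
qed (use assms in simp)

text \<open>The degree sum over \<open>S\<close> counts edges inside \<open>S\<close> twice and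
  edges leaving \<open>S\<close> once, hence the correction by \<open>vol w S\<close>.\<close>

lemma vol_Diff:
  assumes "finite V" "S \<subseteq> V" and sym: "\<And>u v. w u v = w v u"
  shows "vol w V = vol w (V - S) + 2 * (\<Sum>s\<in>S. \<Sum>v\<in>V. w s v) - vol w S"
proof -
  have split: "sum g V = sum g (V - S) + sum g S" for g :: "'a \<Rightarrow> real"
    using sum.subset_diff[OF assms(2,1)] by simp
  have "(\<Sum>u\<in>V - S. \<Sum>v\<in>S. w u v) = (\<Sum>u\<in>S. \<Sum>v\<in>V - S. w u v)"
    by (subst sum.swap) (simp add: sym)
  moreover have "vol w V = vol w (V - S) + (\<Sum>u\<in>V - S. \<Sum>v\<in>S. w u v) + (\<Sum>s\<in>S. \<Sum>v\<in>V. w s v)"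
    unfolding vol_def split[of "\<lambda>u. sum (w u) V"] by (simp add: split[of "w _"] sum.distrib)
  moreover have "(\<Sum>s\<in>S. \<Sum>v\<in>V. w s v) = (\<Sum>u\<in>S. \<Sum>v\<in>V - S. w u v) + vol w S"
    unfolding vol_def by (simp add: split[of "w _"] sum.distrib)
  ultimately show ?thesis by simp
qed

section \<open>Longest paths and their rotations\<close>

definition path_in :: "'a rel \<Rightarrow> 'a set \<Rightarrow> 'a list \<Rightarrow> bool" where
  "path_in E V xs \<longleftrightarrow> xs \<noteq> [] \<and> distinct xs \<and> set xs \<subseteq> V \<and> successively (\<lambda>u v. (u, v) \<in> E) xs"

text \<open>A neighbour of the head off the path would extend the path, and one at index
  \<open>r - 1\<close> or later would close a cycle of length at least \<open>r\<close>.\<close>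

lemma longest_path_neighbours:
  assumes sym: "sym E" and irr: "irrefl E"
    and path: "path_in E V xs" and longest: "\<And>ys. path_in E V ys \<Longrightarrow> length ys \<le> length xs"
    and no_cycle: "\<And>ys. \<lbrakk>is_cycle E ys; set ys \<subseteq> V\<rbrakk> \<Longrightarrow> length ys < r"
    and v: "v \<in> V" "(hd xs, v) \<in> E"
  shows "v \<in> set (take (r - 1) xs)"
proof -
  have v': "(v, hd xs) \<in> E" using sym v(2) by (rule symD)
  have "v \<in> set xs"
  proof (rule ccontr)
    assume "v \<notin> set xs"
    then have "path_in E V (v # xs)" using path v(1) v' by (auto simp: path_in_def successively_Cons)
    with longest show False by fastforce
  qed
  then obtain i where i: "i < length xs" "xs ! i = v" by (auto simp: in_set_conv_nth)
  define ys where "ys = take (Suc i) xs"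
  have "xs \<noteq> []" using i by auto
  have "successively (\<lambda>u v. (u, v) \<in> E) ys"
    using path append_take_drop_id[of "Suc i" xs]
    by (metis path_in_def successively_append_iff ys_def)
  moreover have "last ys = v" using i by (simp add: ys_def take_Suc_conv_app_nth)
  moreover have "hd ys = hd xs" using \<open>xs \<noteq> []\<close> by (simp add: ys_def take_Suc)
  ultimately have "is_cycle E ys"
    using path v' i \<open>xs \<noteq> []\<close> by (intro is_cycle_path) (auto simp: ys_def path_in_def)
  moreover have "set ys \<subseteq> V" using path set_take_subset[of "Suc i" xs] by (auto simp: ys_def path_in_def)
  ultimately have "length ys < r" by (rule no_cycle)
  then have "i < r - 1" using i by (simp add: ys_def)
  then show ?thesis using i by (auto simp: in_set_conv_nth intro!: exI[of _ i])
qed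

text \<open>Posa rotation: after reversing the part before index \<open>i\<close>, the old head is
  followed by its neighbour \<open>xs ! i\<close>, and \<open>xs ! (i - 1)\<close> becomes the
  head.\<close>

lemma path_rotation:
  assumes sym: "sym E" and path: "path_in E V xs" and i: "0 < i" "i < length xs" "(hd xs, xs ! i) \<in> E"
  shows "path_in E V (rev (take i xs) @ drop i xs)"
proof -
  have "xs \<noteq> []" using i by auto
  have E: "(\<lambda>u v. (v, u) \<in> E) = (\<lambda>u v. (u, v) \<in> E)" using sym by (auto simp: fun_eq_iff dest: symD)
  have "successively (\<lambda>u v. (u, v) \<in> E) (take i xs @ drop i xs)" using path by (simp add: path_in_def)
  then have "successively (\<lambda>u v. (u, v) \<in> E) (take i xs)" and drop: "successively (\<lambda>u v. (u, v) \<in> E) (drop i xs)"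
    unfolding successively_append_iff by auto
  then have "successively (\<lambda>u v. (u, v) \<in> E) (rev (take i xs))"
    by (subst successively_rev, subst E)
  moreover have "last (rev (take i xs)) = hd xs" using i \<open>xs \<noteq> []\<close> by (simp add: last_rev hd_take)
  moreover have "hd (drop i xs) = xs ! i" using i by (simp add: hd_drop_conv_nth)
  ultimately have "successively (\<lambda>u v. (u, v) \<in> E) (rev (take i xs) @ drop i xs)"
    using i(3) drop by (simp add: successively_append_iff del: successively_rev)
  moreover have "set (take i xs) \<union> set (drop i xs) = set xs" by (metis append_take_drop_id set_append)
  moreover have "set (take i xs) \<inter> set (drop i xs) = {}"
    using path by (intro set_take_disj_set_drop_if_distinct) (auto simp: path_in_def)
  ultimately show ?thesis using path \<open>xs \<noteq> []\<close> i by (auto simp: path_in_def)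
qed

text \<open>Take a longest path whose head \<open>x\<^sub>0\<close> has the maximal degree \<open>d\<close> among heads of longest paths. Rotating it
  at the neighbours of \<open>x\<^sub>0\<close> yields a set \<open>S\<close> of \<open>d\<close> heads. If there is no long cycle, their neighbours lie
  among the first \<open>r - 1\<close> vertices, so deleting \<open>S\<close> destroys at most \<open>d (r - 1) / 2\<close> edges.\<close>

theorem erdos_gallai_cycle:
  fixes E :: "'a rel"
  assumes "finite V" "V \<noteq> {}" "sym E" "irrefl E" "r \<ge> 2"
    and "vol (adjw E) V \<ge> real (r - 1) * card V"
  shows "\<exists>xs. is_cycle E xs \<and> set xs \<subseteq> V \<and> length xs \<ge> r"
  using assms(1,2,6)
proof (induction "card V" arbitrary: V rule: less_induct)
  case less
  note sym = assms(3) and irr = assms(4)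
  have adjw_sym: "adjw E u v = adjw E v u" for u v using sym by (auto dest: symD)
  show ?case
  proof (rule ccontr)
    assume "\<not> ?case"
    then have no_cycle: "\<And>ys. \<lbrakk>is_cycle E ys; set ys \<subseteq> V\<rbrakk> \<Longrightarrow> length ys < r" by (meson not_le)
    define N where "N u = {v \<in> V. (u, v) \<in> E}" for u
    have deg: "(\<Sum>v\<in>V. adjw E u v) = card (N u)" for u
      using less.prems(1) by (simp add: N_def sum.If_cases of_bool_def Int_def)
    have finN: "finite (N u)" for u using less.prems(1) by (simp add: N_def)

    obtain v\<^sub>0 where "v\<^sub>0 \<in> V" using less.prems(2) by auto
    then have "path_in E V [v\<^sub>0]" by (simp add: path_in_def)
    moreover have "\<forall>ys. path_in E V ys \<longrightarrow> length ys < Suc (card V)"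
      using less.prems(1) by (auto simp: path_in_def less_Suc_eq_le distinct_card[symmetric] intro: card_mono)
    ultimately obtain zs where zs: "path_in E V zs" "\<And>ys. path_in E V ys \<Longrightarrow> length ys \<le> length zs"
      using ex_has_greatest_nat[of "path_in E V" "[v\<^sub>0]" length] by blast
    define longest where "longest ys \<longleftrightarrow> path_in E V ys \<and> length ys = length zs" for ys
    have "longest zs" using zs(1) by (simp add: longest_def)
    moreover have "\<forall>ys. longest ys \<longrightarrow> card (N (hd ys)) < Suc (card V)"
      using less.prems(1) by (auto simp: less_Suc_eq_le N_def intro: card_mono)
    ultimately obtain xs where xs: "longest xs" "\<And>ys. longest ys \<Longrightarrow> card (N (hd ys)) \<le> card (N (hd xs))"
      using ex_has_greatest_nat[of longest zs "\<lambda>ys. card (N (hd ys))"] by blast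
    define d x\<^sub>0 where "d = card (N (hd xs))" and "x\<^sub>0 = hd xs"
    have path: "path_in E V xs" and "length xs = length zs" using xs(1) by (auto simp: longest_def)
    then have xsne: "xs \<noteq> []" and dist: "distinct xs" and xsV: "set xs \<subseteq> V" by (auto simp: path_in_def)
    have x\<^sub>0: "x\<^sub>0 \<in> V" "xs ! 0 = x\<^sub>0" using xsne xsV by (auto simp: x\<^sub>0_def hd_conv_nth)
    have x\<^sub>0N: "x\<^sub>0 \<notin> N x\<^sub>0" using irr by (simp add: N_def irrefl_def)
    define W where "W = set (take (r - 1) xs)"
    have cW: "card W \<le> r - 1" unfolding W_def by (metis card_length length_take min.cobounded2 order_trans)
    have nbrs: "N (hd ys) \<subseteq> set (take (r - 1) ys)" if "longest ys" for ys
      using longest_path_neighbours[OF sym irr _ _ no_cycle] that zs(2) by (auto simp: N_def longest_def)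

    define I where "I = {i. i < length xs \<and> xs ! i \<in> N x\<^sub>0}"
    have I0: "0 < i" "i < length xs" "(hd xs, xs ! i) \<in> E" "i < r - 1" if "i \<in> I" for i
    proof -
      show "i < length xs" "(hd xs, xs ! i) \<in> E" using that by (auto simp: I_def N_def x\<^sub>0_def)
      show "0 < i" using that x\<^sub>0N x\<^sub>0(2) by (cases i) (auto simp: I_def)
      have "xs ! i \<in> W" using that nbrs[OF xs(1)] by (auto simp: I_def x\<^sub>0_def W_def)
      then obtain j where "j < r - 1" "j < length xs" "xs ! j = xs ! i"
        by (auto simp: W_def in_set_conv_nth)
      then show "i < r - 1" using dist \<open>i < length xs\<close> by (simp add: nth_eq_iff_index_eq)
    qed
    have "(\<lambda>i. xs ! i) ` I = N x\<^sub>0"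
    proof -
      have "N x\<^sub>0 \<subseteq> set xs" using nbrs[OF xs(1)] set_take_subset[of "r - 1" xs] by (auto simp: x\<^sub>0_def)
      then show ?thesis by (fastforce simp: I_def in_set_conv_nth)
    qed
    moreover have "inj_on (\<lambda>i. xs ! i) I" using dist by (auto simp: inj_on_def I_def nth_eq_iff_index_eq)
    ultimately have cI: "card I = d" using card_image by (fastforce simp: d_def x\<^sub>0_def)
    \<comment> \<open>These are the heads of the rotated paths. All indices in \<open>I\<close> are
      positive, so \<open>i - 1\<close> is never truncated.\<close>
    define S where "S = (\<lambda>i. xs ! (i - 1)) ` I"
    have "inj_on (\<lambda>i. xs ! (i - 1)) I"
    proof (rule inj_onI)
      fix i j assume ij: "i \<in> I" "j \<in> I" "xs ! (i - 1) = xs ! (j - 1)"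
      then have "i - 1 = j - 1" using dist I0(1,2)[OF ij(1)] I0(1,2)[OF ij(2)] by (simp add: nth_eq_iff_index_eq)
      then show "i = j" using I0(1)[OF ij(1)] I0(1)[OF ij(2)] by simp
    qed
    then have cS: "card S = d" by (simp add: S_def card_image cI)
    have SW: "S \<subseteq> W"
    proof
      fix s assume "s \<in> S"
      then obtain i where i: "i \<in> I" "s = xs ! (i - 1)" by (auto simp: S_def)
      then show "s \<in> W" using I0[OF i(1)] by (auto simp: W_def in_set_conv_nth intro!: exI[of _ "i - 1"])
    qed
    have SV: "S \<subseteq> V" using SW set_take_subset[of "r - 1" xs] xsV by (auto simp: W_def)
    have finS: "finite S" using SV less.prems(1) by (rule finite_subset)
    have NS: "N s \<subseteq> W \<and> card (N s) \<le> d" if s: "s \<in> S" for s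
    proof -
      obtain i where i: "i \<in> I" "s = xs ! (i - 1)" using s unfolding S_def by blast
      note i' = I0[OF i(1)]
      define ys where "ys = rev (take i xs) @ drop i xs"
      have "longest ys"
        using path_rotation[OF sym path i'(1-3)] xs(1) i'(2) by (auto simp: longest_def ys_def)
      moreover have "hd ys = s"
      proof -
        have "take i xs \<noteq> []" using i'(1) xsne by simp
        then have "hd ys = last (take i xs)" by (simp add: ys_def hd_rev)
        also have "\<dots> = s" using i' i(2) last_conv_nth[OF \<open>take i xs \<noteq> []\<close>] by simp
        finally show ?thesis .
      qed
      \<comment> \<open>A rotation permutes only vertices before index \<open>r - 1\<close>, so all
        rotated paths share the window \<open>W\<close>.\<close>
      moreover have "set (take (r - 1) ys) = W"
      proof -
        have "take (r - 1) ys = rev (take i xs) @ take (r - 1 - i) (drop i xs)" using i' by (simp add: ys_def)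
        moreover have "take (r - 1) xs = take i xs @ take (r - 1 - i) (drop i xs)"
          using i'(4) take_add[of i "r - 1 - i" xs] by simp
        ultimately show ?thesis by (simp add: W_def)
      qed
      ultimately show ?thesis using nbrs[of ys] xs(2)[of ys] by (auto simp: d_def)
    qed

    \<comment> \<open>If the head is isolated, \<open>S\<close> is empty, and the head itself is
      deleted instead.\<close>
    define S' where "S' = (if d = 0 then {x\<^sub>0} else S)"
    have S': "S' \<subseteq> V" "S' \<noteq> {}" using SV x\<^sub>0(1) cS by (auto simp: S'_def)
    have "vol (adjw E) (V - S') \<ge> vol (adjw E) V - real (r - 1) * card S'"
    proof (cases "d = 0")
      case True
      have "(\<Sum>v\<in>V. adjw E x\<^sub>0 v) = 0" using True unfolding deg by (simp add: d_def x\<^sub>0_def)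
      moreover have "vol (adjw E) S' = 0" using True irr by (simp add: S'_def vol_def irrefl_def)
      ultimately show ?thesis
        using vol_Diff[where w = "adjw E", OF less.prems(1) S'(1) adjw_sym] True by (simp add: S'_def)
    next
      case False
      then have S'S: "S' = S" by (simp add: S'_def)
      \<comment> \<open>At most \<open>r - 1 - d\<close> neighbours of \<open>s\<close> lie in
        \<open>W - S\<close>, and its degree is at most \<open>d\<close>. In this form the degree
        sums cancel in \<open>vol_Diff\<close>.\<close>
      have "(\<Sum>v\<in>S. adjw E s v) \<ge> 2 * real (card (N s)) - (real (r - 1) - d) - d" if s: "s \<in> S" for s
      proof -
        have "card (N s) \<le> card (N s \<inter> S) + card (W - S)"
        proof -
          have "N s \<subseteq> (N s \<inter> S) \<union> (W - S)" using NS[OF s] by blast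
          then have "card (N s) \<le> card ((N s \<inter> S) \<union> (W - S))"
            by (intro card_mono) (auto simp: W_def finS)
          then show ?thesis using card_Un_le order_trans by blast
        qed
        moreover have "card (W - S) \<le> r - 1 - d" using cW SW finS by (simp add: card_Diff_subset cS)
        moreover have "d \<le> r - 1" using card_mono[OF _ SW] cW cS by (simp add: W_def)
        moreover have "(\<Sum>v\<in>S. adjw E s v) = card (N s \<inter> S)"
        proof -
          have "{v \<in> S. (s, v) \<in> E} = N s \<inter> S" using SV by (auto simp: N_def)
          then show ?thesis using finS by (simp add: sum.If_cases of_bool_def Int_def)
        qed
        moreover have "card (N s) \<le> d" using NS[OF s] by simp
        ultimately show ?thesis by linarith
      qed
      then have "(\<Sum>s\<in>S. 2 * real (card (N s)) - real (r - 1)) \<le> vol (adjw E) S"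
        unfolding vol_def by (intro sum_mono) simp
      then have "2 * (\<Sum>s\<in>S. real (card (N s))) - real (r - 1) * card S \<le> vol (adjw E) S"
        by (simp add: sum_subtractf sum_distrib_left mult.commute)
      then show ?thesis
        using vol_Diff[where w = "adjw E", OF less.prems(1) S'(1) adjw_sym] unfolding S'S deg by simp
    qed
    moreover have card': "real (card (V - S')) = real (card V) - card S'"
      using S'(1) less.prems(1) finite_subset[OF S'(1)]
      by (simp add: card_Diff_subset of_nat_diff card_mono)
    ultimately have dense: "vol (adjw E) (V - S') \<ge> real (r - 1) * card (V - S')"
      using less.prems(3) unfolding card' by (simp add: right_diff_distrib)
    \<comment> \<open>A single isolated vertex is not dense enough, and \<open>d\<close> vertices
      cannot exhaust \<open>V\<close> because the head is not its own neighbour.\<close>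
    have "V - S' \<noteq> {}"
    proof
      assume "V - S' = {}"
      then have "S' = V" using S'(1) by blast
      show False
      proof (cases "d = 0")
        case True
        then have "V = {x\<^sub>0}" using \<open>S' = V\<close> by (simp add: S'_def)
        moreover have "vol (adjw E) {x\<^sub>0} = 0" using irr by (simp add: vol_def irrefl_def)
        ultimately have "real (r - 1) * real (card V) \<le> 0" using less.prems(3) by metis
        then show False using less.prems(1,2) assms(5) by (simp add: mult_le_0_iff)
      next
        case False
        then have "card V = d" using \<open>S' = V\<close> cS by (simp add: S'_def)
        moreover have "N x\<^sub>0 \<subset> V" using x\<^sub>0(1) x\<^sub>0N by (auto simp: N_def)
        then have "card (N x\<^sub>0) < card V" by (rule psubset_card_mono[OF less.prems(1)])
        ultimately show False by (simp add: d_def x\<^sub>0_def)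
      qed
    qed
    moreover have "card (V - S') < card V"
      using S' less.prems(1) by (intro psubset_card_mono) auto
    ultimately obtain ys where "is_cycle E ys" "set ys \<subseteq> V - S'" "length ys \<ge> r"
      using less.hyps[of "V - S'"] dense less.prems(1) by auto
    then show False using no_cycle[of ys] by auto
  qed
qed

section \<open>Packing disjoint cycles\<close>

definition cycle_packing :: "'a rel \<Rightarrow> 'a set \<Rightarrow> nat \<Rightarrow> nat \<Rightarrow> (nat \<Rightarrow> 'a list) \<Rightarrow> bool" where
  "cycle_packing E V k r cs \<longleftrightarrow>
     (\<forall>i<k. is_cycle E (cs i) \<and> set (cs i) \<subseteq> V \<and> r \<le> length (cs i)) \<and>
     (\<forall>i<k. \<forall>j<k. i \<noteq> j \<longrightarrow> set (cs i) \<inter> set (cs j) = {})"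

text \<open>An enumeration of the clique is cut into consecutive blocks of \<open>r\<close>
  vertices.\<close>

lemma clique_cycle_packing:
  assumes "finite K" "k * r \<le> card K" "r \<ge> 2"
    and clique: "\<And>u v. \<lbrakk>u \<in> K; v \<in> K; u \<noteq> v\<rbrakk> \<Longrightarrow> (u, v) \<in> E"
  shows "\<exists>cs. cycle_packing E K k r cs"
proof -
  obtain f where "bij_betw f {0..<card K} K" using ex_bij_betw_nat_finite[OF assms(1)] by blast
  then have inj: "inj_on f {0..<card K}" and im: "f ` {0..<card K} = K" by (auto simp: bij_betw_def)
  define cs where "cs i = map f [i * r..<i * r + r]" for i
  have sub: "{i * r..<i * r + r} \<subseteq> {0..<card K}" if "i < k" for i
  proof -
    have "Suc i * r \<le> k * r" using that by (intro mult_le_mono1) simp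
    with assms(2) show ?thesis by auto
  qed
  have "is_cycle E (cs i)" if i: "i < k" for i
  proof (rule is_cycle_path)
    show dist: "distinct (cs i)"
      using inj_on_subset[OF inj sub[OF i]] by (simp add: cs_def distinct_map)
    show "cs i \<noteq> []" using assms(3) by (simp add: cs_def)
    have K: "set (cs i) \<subseteq> K" using im sub[OF i] by (auto simp: cs_def)
    show "successively (\<lambda>u v. (u, v) \<in> E) (cs i)"
      using dist K by (auto simp: successively_conv_nth nth_eq_iff_index_eq subset_iff intro!: clique)
    have len: "length (cs i) = r" by (simp add: cs_def)
    then have "last (cs i) = cs i ! (r - 1)" "hd (cs i) = cs i ! 0"
      using \<open>cs i \<noteq> []\<close> by (simp_all add: last_conv_nth hd_conv_nth)
    moreover have "cs i ! (r - 1) \<noteq> cs i ! 0"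
      using dist len assms(3) by (simp add: nth_eq_iff_index_eq)
    moreover have "cs i ! (r - 1) \<in> K" "cs i ! 0 \<in> K"
      using len assms(3) by (intro subsetD[OF K] nth_mem; simp)+
    ultimately show "(last (cs i), hd (cs i)) \<in> E" by (simp add: clique)
  qed
  moreover have "set (cs i) \<inter> set (cs j) = {}" if "i < j" "j < k" for i j
  proof -
    have "Suc i * r \<le> j * r" using that by (intro mult_le_mono1) simp
    then have "{i * r..<i * r + r} \<inter> {j * r..<j * r + r} = {}" by auto
    then show ?thesis
      using inj_on_image_Int[OF inj sub[of i] sub[of j]] that by (simp add: cs_def)
  qed
  then have "set (cs i) \<inter> set (cs j) = {}" if "i < k" "j < k" "i \<noteq> j" for i j
    using that by (metis inf_commute linorder_neqE_nat)
  moreover have "set (cs i) \<subseteq> K" if "i < k" for i using im sub[OF that] by (auto simp: cs_def)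
  ultimately show ?thesis by (intro exI[of _ cs]) (auto simp: cycle_packing_def cs_def)
qed

lemma cycle_packing_join:
  assumes "cycle_packing E A j r cs" "cycle_packing E B l r ds" "A \<inter> B = {}" "A \<subseteq> V" "B \<subseteq> V"
  shows "cycle_packing E V (j + l) r (\<lambda>i. if i < j then cs i else ds (i - j))"
proof -
  have 1: "set (cs i) \<subseteq> A" if "i < j" for i using assms(1) that by (simp add: cycle_packing_def)
  have 2: "set (ds (i - j)) \<subseteq> B" if "i < j + l" "\<not> i < j" for i
    using assms(2) that by (simp add: cycle_packing_def)
  have "set (cs i) \<inter> set (ds (i' - j)) = {}" if "i < j" "i' < j + l" "\<not> i' < j" for i i'
    using 1[OF that(1)] 2[OF that(2,3)] assms(3) by blast
  moreover have "set (cs i) \<subseteq> V" if "i < j" for i using 1[OF that] assms(4) by blast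
  moreover have "set (ds (i - j)) \<subseteq> V" if "i < j + l" "\<not> i < j" for i using 2[OF that] assms(5) by blast
  ultimately show ?thesis
    using assms(1,2) unfolding cycle_packing_def by (auto simp: Int_commute)
qed

text \<open>The left side is the clique bound of \<open>dense_decomposition\<close> for
  \<open>p = j / k\<close>. It therefore suffices there to exclude cliques on \<open>k * r\<close>
  vertices.\<close>

lemma near_half_bound:
  fixes k r :: nat
  assumes "k \<ge> 2" "r \<ge> 3"
  defines "j \<equiv> k div 2"
  shows "8 * (real j / k) * (1 - real j / k) * (2 * real k * real r / 3 - 1) \<ge> real k * real r - 1"
proof -
  define x y where "x = real k" and "y = real r"
  have xy: "x \<ge> 2" "y \<ge> 3" using assms by (auto simp: x_def y_def)
  \<comment> \<open>The claim multiplied by \<open>3 * x\<^sup>2\<close> to clear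
    denominators.\<close>
  have "3 * x\<^sup>2 * (x * y - 1) \<le> 8 * real j * (x - j) * (2 * x * y - 3)"
  proof (cases "even k")
    case True
    then have j: "real j = x / 2" by (auto simp: j_def x_def real_of_nat_div)
    have "x * y \<ge> 2 * 3" using xy by (intro mult_mono) auto
    then have "x\<^sup>2 * (3 * (x * y - 1)) \<le> x\<^sup>2 * (2 * (2 * x * y - 3))"
      by (intro mult_left_mono) (auto simp: algebra_simps)
    then show ?thesis unfolding j by (simp add: algebra_simps power2_eq_square)
  next
    case False
    then have j: "real j = (x - 1) / 2" by (auto simp: j_def x_def elim!: oddE)
    have "k \<ge> 3" using False assms(1) by (cases "k = 2") auto
    then have x3: "x \<ge> 3" by (simp add: x_def)
    have xy9: "x * y \<ge> 3 * 3" using xy x3 by (intro mult_mono) auto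
    \<comment> \<open>For odd \<open>k\<close> the claim amounts to
      \<open>4 * x * y - 6 \<le> x * x * (x * y - 3)\<close>, and here \<open>x * x\<close> is at
      least 9.\<close>
    have "3 * 3 * (x * y - 3) \<le> (x * x) * (x * y - 3)"
      using xy9 x3 by (intro mult_right_mono mult_mono) auto
    have j': "8 * real j * (x - j) = 2 * (x * x - 1)" unfolding j by (simp add: field_simps)
    show ?thesis unfolding j' using xy9 \<open>3 * 3 * _ \<le> _\<close> by (simp add: algebra_simps power2_eq_square)
  qed
  moreover define a where "a = real j / x"
  then have ja: "real j = a * x" using xy by simp
  have "3 * x\<^sup>2 * (8 * a * (1 - a) * (2 * x * y / 3 - 1)) = 8 * real j * (x - j) * (2 * x * y - 3)"
    unfolding ja by (simp add: field_simps power2_eq_square)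
  ultimately have "3 * x\<^sup>2 * (x * y - 1) \<le> 3 * x\<^sup>2 * (8 * a * (1 - a) * (2 * x * y / 3 - 1))" by linarith
  moreover have "3 * x\<^sup>2 > 0" using xy by simp
  ultimately have "x * y - 1 \<le> 8 * a * (1 - a) * (2 * x * y / 3 - 1)" by (simp only: mult_le_cancel_left_pos)
  then show ?thesis by (simp add: a_def x_def y_def)
qed

text \<open>The density plus 1 is proportional to the number of cycles. Sharing it in the ratio
  \<open>j : k - j\<close> gives the two parts exactly the densities that the induction asks
  for.\<close>

theorem dense_cycle_packing:
  fixes E :: "'a rel"
  assumes "sym E" "irrefl E" "r \<ge> 3"
    and "finite V" "V \<noteq> {}" "k \<ge> 1"
    and "vol (adjw E) V \<ge> 2 * (2 * real k * real r / 3 - 1) * card V"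
  shows "\<exists>cs. cycle_packing E V k r cs"
  using assms(4-)
proof (induction k arbitrary: V rule: less_induct)
  case (less k)
  note V = less.prems(1,2) and dense = less.prems(4)
  consider "k = 1" | K where "k \<ge> 2" "K \<subseteq> V" "\<And>u v. \<lbrakk>u \<in> K; v \<in> K; u \<noteq> v\<rbrakk> \<Longrightarrow> (u, v) \<in> E" "k * r \<le> card K"
    | "k \<ge> 2" "\<And>K. \<lbrakk>K \<subseteq> V; \<And>u v. \<lbrakk>u \<in> K; v \<in> K; u \<noteq> v\<rbrakk> \<Longrightarrow> (u, v) \<in> E\<rbrakk> \<Longrightarrow> card K < k * r"
    using less.prems(3) by (metis One_nat_def Suc_1 Suc_leI le_neq_implies_less not_le)
  then show ?case
  proof cases
    case 1
    \<comment> \<open>For one cycle the factor is \<open>4 * r / 3 - 2\<close>, which is at least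
      \<open>r - 1\<close> exactly when \<open>r \<ge> 3\<close>.\<close>
    have "real (r - 1) * card V \<le> 2 * (2 * real k * real r / 3 - 1) * card V"
      using 1 assms(3) by (intro mult_right_mono) auto
    with dense have "real (r - 1) * card V \<le> vol (adjw E) V" by linarith
    then obtain xs where "is_cycle E xs" "set xs \<subseteq> V" "length xs \<ge> r"
      using erdos_gallai_cycle[OF V assms(1,2), of r] assms(3) by auto
    then show ?thesis using 1 by (intro exI[of _ "\<lambda>_. xs"]) (simp add: cycle_packing_def)
  next
    case (2 K)
    then obtain cs where "cycle_packing E K k r cs"
      using clique_cycle_packing[of K k r E] finite_subset[OF 2(2) V(1)] assms(3) by auto
    then show ?thesis using 2(2) by (auto simp: cycle_packing_def)
  next
    case 3
    define j where "j = k div 2"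
    have j: "1 \<le> j" "j < k" "1 \<le> k - j" "k - j < k" "k = j + (k - j)" using 3(1) by (auto simp: j_def)
    define p c where "p = real j / k" and "c = 2 * real k * real r / 3 - 1"
    have p: "0 < p" "p < 1" using j by (auto simp: p_def)
    have pc: "p * c + p = 2 * real j * real r / 3" "(1 - p) * c + (1 - p) = 2 * real (k - j) * real r / 3"
      using j by (auto simp: p_def c_def of_nat_diff field_simps)
    have jr: "1 * 3 \<le> real j * real r" "1 * 3 \<le> real (k - j) * real r"
      using j assms(3) by (intro mult_mono; simp)+
    have pc1: "p * c > 1" "(1 - p) * c > 1" using pc jr p by linarith+
    have cliques: "card K \<le> 8 * p * (1 - p) * c"
      if "K \<subseteq> V" "\<And>u v. \<lbrakk>u \<in> K; v \<in> K; u \<noteq> v\<rbrakk> \<Longrightarrow> adjw E u v = 1" for K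
    proof -
      have "card K < k * r" using that by (intro 3(2)) auto
      then have "real (card K) + 1 \<le> real k * real r"
        by (metis Suc_leI of_nat_Suc of_nat_le_iff of_nat_mult add.commute)
      then show ?thesis using near_half_bound[OF 3(1) assms(3)] by (simp add: p_def c_def j_def)
    qed
    have "vol (adjw E) V \<ge> 2 * c * card V" using dense by (simp add: c_def)
    moreover have "adjw E u v = adjw E v u" "adjw E u u = 0" "adjw E u v \<in> {0, 1}" for u v
      using assms(1,2) by (auto simp: irrefl_def dest: symD)
    ultimately obtain A B where AB: "A \<subseteq> V" "B \<subseteq> V" "A \<inter> B = {}" "A \<noteq> {}" "B \<noteq> {}"
      "vol (adjw E) A \<ge> 2 * (p * c - (1 - p)) * card A" "vol (adjw E) B \<ge> 2 * ((1 - p) * c - p) * card B"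
      using dense_decomposition[where w = "adjw E", OF V _ _ _ _ p pc1 cliques] by blast
    have fin: "finite A" "finite B" using AB(1,2) V(1) by (auto intro: finite_subset)
    have "p * c - (1 - p) = 2 * real j * real r / 3 - 1" "(1 - p) * c - p = 2 * real (k - j) * real r / 3 - 1"
      using pc by linarith+
    with AB(6,7) obtain cs ds where "cycle_packing E A j r cs" "cycle_packing E B (k - j) r ds"
      using less.IH[OF j(2) fin(1) AB(4) j(1)] less.IH[OF j(4) fin(2) AB(5) j(3)] by auto
    then have "cycle_packing E V (j + (k - j)) r (\<lambda>i. if i < j then cs i else ds (i - j))"
      using AB(1-3) by (intro cycle_packing_join)
    then show ?thesis using j(5) by metis
  qed
qed

section \<open>From packed cycles to the minor\<close>

definition cycle_arcs :: "'a list \<Rightarrow> 'a rel" where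
  "cycle_arcs xs = set (zip xs (rotate1 xs)) \<union> (set (zip xs (rotate1 xs)))\<inverse>"

definition cycle_graph :: "nat \<Rightarrow> (nat \<Rightarrow> 'a list) \<Rightarrow> 'a pair_pre_digraph" where
  "cycle_graph k cs = \<lparr> pverts = (\<Union>i<k. set (cs i)), parcs = (\<Union>i<k. cycle_arcs (cs i)) \<rparr>"

lemma cycle_arcs_subset: "cycle_arcs xs \<subseteq> set xs \<times> set xs"
  by (auto simp: cycle_arcs_def dest: set_zip_leftD set_zip_rightD)

text \<open>The index form matches the arcs of \<open>disjoint_cycles\<close>.\<close>

lemma cycle_arcs_nth:
  "cycle_arcs xs = {(xs ! a, xs ! b) |a b. a < length xs \<and> b < length xs \<and>
     (b = Suc a mod length xs \<or> a = Suc b mod length xs)}"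
proof -
  have 1: "set (zip xs (rotate1 xs)) = {(xs ! a, xs ! (Suc a mod length xs)) |a. a < length xs}"
    by (auto simp: set_zip nth_rotate1)
  have 2: "Suc a mod length xs < length xs" if "a < length xs" for a
    using that by (intro mod_less_divisor) auto
  show ?thesis (is "_ = ?R")
  proof
    show "cycle_arcs xs \<subseteq> ?R" unfolding cycle_arcs_def 1 using 2 by blast
    show "?R \<subseteq> cycle_arcs xs" unfolding cycle_arcs_def 1 by blast
  qed
qed

lemma sym_cycle_arcs: "sym (cycle_arcs xs)"
  by (auto simp: cycle_arcs_def sym_def)

lemma irrefl_cycle_arcs:
  assumes "distinct xs" "length xs \<ge> 2"
  shows "irrefl (cycle_arcs xs)"
proof -
  have "a \<noteq> Suc a mod length xs" if "a < length xs" for a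
    using that assms(2) by (cases "Suc a = length xs") auto
  then show ?thesis using assms(1) by (auto simp: irrefl_def cycle_arcs_nth nth_eq_iff_index_eq)
qed

text \<open>Surplus vertices are deleted first, then surplus edges. Deleting both arcs of an edge
  loses nothing of \<open>H\<close> because \<open>H\<close> is symmetric.\<close>

lemma subgraph_minor:
  assumes "pair_graph G" "pair_graph H" "pverts H \<subseteq> pverts G" "parcs H \<subseteq> parcs G"
  shows "minor_step\<^sup>*\<^sup>* G H"
  using assms(1,3,4)
proof (induction "card (pverts G) + card (parcs G)" arbitrary: G rule: less_induct)
  case less
  interpret G: pair_graph G by fact
  interpret H: pair_graph H by fact
  have step: "minor_step\<^sup>*\<^sup>* G H"
    if "minor_step G G'" "pverts H \<subseteq> pverts G'" "parcs H \<subseteq> parcs G'"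
      "pverts G' \<subseteq> pverts G" "parcs G' \<subseteq> parcs G" "pverts G' \<noteq> pverts G \<or> parcs G' \<noteq> parcs G" for G'
  proof -
    have "card (pverts G') \<le> card (pverts G)" "card (parcs G') \<le> card (parcs G)"
      using that(4,5) by (auto intro: card_mono)
    moreover have "card (pverts G') < card (pverts G) \<or> card (parcs G') < card (parcs G)"
      using that(4-6) psubset_card_mono[of "pverts G" "pverts G'"] psubset_card_mono[of "parcs G" "parcs G'"]
      by auto
    ultimately have "card (pverts G') + card (parcs G') < card (pverts G) + card (parcs G)" by linarith
    then have "minor_step\<^sup>*\<^sup>* G' H"
      using that(2,3) minor_step_pair_graph[OF that(1) less.prems(1)] by (intro less.hyps)
    with that(1) show ?thesis by (rule converse_rtranclp_into_rtranclp)
  qed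
  show ?case
  proof (cases "\<exists>v. v \<in> pverts G - pverts H")
    case True
    then obtain v where v: "v \<in> pverts G" "v \<notin> pverts H" by blast
    have "fst e \<noteq> v \<and> snd e \<noteq> v" if "e \<in> parcs H" for e
      using that v(2) H.arc_fst_in_verts H.arc_snd_in_verts by blast
    then show ?thesis
      using v less.prems(2,3) by (intro step[OF minor_step.delete_vertex[OF v(1)]]) (auto simp: delete_vertex_def)
  next
    case False
    then have verts: "pverts H = pverts G" using less.prems(2) by blast
    show ?thesis
    proof (cases "\<exists>u v. (u, v) \<in> parcs G - parcs H")
      case True
      then obtain u v where uv: "(u, v) \<in> parcs G" "(u, v) \<notin> parcs H" by blast
      then have "(v, u) \<notin> parcs H" using H.arcs_symmetric by blast
      then show ?thesis
        using uv less.prems(2,3) by (intro step[OF minor_step.delete_edge[OF uv(1)]]) (auto simp: delete_edge_def)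
    next
      case False
      then have "parcs H = parcs G" using less.prems(3) by auto
      with verts have "H = G" by (intro pair_pre_digraph.equality) auto
      then show ?thesis by simp
    qed
  qed
qed

section \<open>Contracting long cycles\<close>

text \<open>These pairs run from \<open>z\<close> through \<open>zs\<close> back to
  \<open>x\<close>; they are the part of the cycle that contracting the vertex before
  \<open>z\<close> into \<open>x\<close> leaves alone.\<close>

lemma zip_shift:
  assumes "distinct (x # z # zs)" "(a, b) \<in> set (zip (z # zs) (zs @ [x]))"
  shows "a \<noteq> b \<and> a \<in> set (z # zs) \<and> b \<in> set (x # zs)"
  using assms by (induction zs arbitrary: z) auto

text \<open>The edge \<open>xy\<close> becomes a loop and disappears, \<open>yz\<close> becomes
  \<open>xz\<close>, and no other arc meets \<open>y\<close>. The rest of the graph is kept in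
  \<open>U\<close> and \<open>R\<close>.\<close>

lemma contract_edge_cycle:
  assumes xs: "distinct (x # y # z # zs)" and U: "U \<inter> set (x # y # z # zs) = {}"
    and R: "R \<subseteq> U \<times> U" "irrefl R"
  shows "contract_edge x y \<lparr>pverts = U \<union> set (x # y # z # zs), parcs = R \<union> cycle_arcs (x # y # z # zs)\<rparr> =
    \<lparr>pverts = U \<union> set (x # z # zs), parcs = R \<union> cycle_arcs (x # z # zs)\<rparr>"
proof -
  define f where "f = (\<lambda>v. if v = y then x else v)"
  define P where "P = set (zip (z # zs) (zs @ [x])) \<union> (set (zip (z # zs) (zs @ [x])))\<inverse>"
  have arcs: "cycle_arcs (x # y # z # zs) = {(x, y), (y, x), (y, z), (z, y)} \<union> P"
    "cycle_arcs (x # z # zs) = {(x, z), (z, x)} \<union> P"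
    by (auto simp: cycle_arcs_def P_def)
  have P: "a \<noteq> b \<and> a \<noteq> y \<and> b \<noteq> y" if "(a, b) \<in> P" for a b
    using that zip_shift[of x z zs a b] zip_shift[of x z zs b a] xs by (auto simp: P_def)
  have R': "a \<noteq> b \<and> a \<noteq> y \<and> b \<noteq> y" if "(a, b) \<in> R" for a b
    using that R U by (auto simp: irrefl_def)
  have "{(f a, f b) |a b. (a, b) \<in> R \<union> ({(x, y), (y, x), (y, z), (z, y)} \<union> P) \<and> f a \<noteq> f b}
    = R \<union> ({(x, z), (z, x)} \<union> P)" (is "?L = ?R")
  proof
    show "?L \<subseteq> ?R" using P R' xs by (auto simp: f_def)
    have "(a, b) \<in> ?L" if "(a, b) \<in> R \<union> P" for a b
    proof -
      have "f a = a" "f b = b" "a \<noteq> b" using that P R' by (auto simp: f_def)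
      with that show ?thesis by (intro CollectI exI[of _ a] exI[of _ b]) auto
    qed
    moreover have "(x, z) \<in> ?L" using xs
      by (intro CollectI exI[of _ y] exI[of _ z]) (auto simp: f_def)
    moreover have "(z, x) \<in> ?L" using xs
      by (intro CollectI exI[of _ z] exI[of _ y]) (auto simp: f_def)
    ultimately show "?R \<subseteq> ?L" by auto
  qed
  moreover have "f ` (U \<union> set (x # y # z # zs)) = U \<union> set (x # z # zs)"
    using xs U by (auto simp: f_def image_iff)
  ultimately show ?thesis by (simp only: contract_edge_def Let_def f_def[symmetric] arcs pair_pre_digraph.simps)
qed

lemma shrink_cycle:
  assumes "distinct xs" "r \<le> length xs" "r \<ge> 2" "U \<inter> set xs = {}" "R \<subseteq> U \<times> U" "irrefl R"
  shows "\<exists>ys. distinct ys \<and> length ys = r \<and> set ys \<subseteq> set xs \<and>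
    minor_step\<^sup>*\<^sup>* \<lparr>pverts = U \<union> set xs, parcs = R \<union> cycle_arcs xs\<rparr>
      \<lparr>pverts = U \<union> set ys, parcs = R \<union> cycle_arcs ys\<rparr>"
  using assms(1,2,4)
proof (induction "length xs" arbitrary: xs rule: less_induct)
  case less
  show ?case
  proof (cases "length xs = r")
    case True
    with less.prems show ?thesis by blast
  next
    case False
    \<comment> \<open>A cycle longer than \<open>r\<close> has at least three vertices, enough for
      one more contraction.\<close>
    with less.prems(2) assms(3) have "length xs \<ge> 3" by linarith
    then obtain x y z zs where xs: "xs = x # y # z # zs"
      by (auto simp: numeral_3_eq_3 Suc_le_length_iff)
    have "(x, y) \<in> cycle_arcs xs" by (simp add: xs cycle_arcs_def)
    then have step: "minor_step \<lparr>pverts = U \<union> set xs, parcs = R \<union> cycle_arcs xs\<rparr>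
      \<lparr>pverts = U \<union> set (x # z # zs), parcs = R \<union> cycle_arcs (x # z # zs)\<rparr>"
      using minor_step.contract_edge[of x y "\<lparr>pverts = U \<union> set xs, parcs = R \<union> cycle_arcs xs\<rparr>"]
        contract_edge_cycle[of x y z zs U R] less.prems assms(5,6) unfolding xs by simp
    have "length (x # z # zs) < length xs" "distinct (x # z # zs)" "r \<le> length (x # z # zs)"
      "U \<inter> set (x # z # zs) = {}"
      using less.prems False by (auto simp: xs)
    from less.hyps[OF this] obtain ys where "distinct ys" "length ys = r" "set ys \<subseteq> set (x # z # zs)"
      "minor_step\<^sup>*\<^sup>* \<lparr>pverts = U \<union> set (x # z # zs), parcs = R \<union> cycle_arcs (x # z # zs)\<rparr>
        \<lparr>pverts = U \<union> set ys, parcs = R \<union> cycle_arcs ys\<rparr>" by blast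
    then show ?thesis using converse_rtranclp_into_rtranclp[where r = minor_step, OF step]
      by (intro exI[of _ ys]) (auto simp: xs)
  qed
qed

text \<open>The cycles are shrunk one at a time; \<open>m\<close> counts those already of length
  \<open>r\<close>. Each keeps within its original vertex set, which preserves disjointness.\<close>

lemma shrink_cycles:
  assumes cs: "\<And>i. i < k \<Longrightarrow> distinct (cs i) \<and> r \<le> length (cs i)" and r: "r \<ge> 2"
    and disj: "\<And>i j. \<lbrakk>i < k; j < k; i \<noteq> j\<rbrakk> \<Longrightarrow> set (cs i) \<inter> set (cs j) = {}"
    and "m \<le> k"
  shows "\<exists>ds. (\<forall>i<m. length (ds i) = r) \<and> (\<forall>i<k. distinct (ds i) \<and> r \<le> length (ds i) \<and> set (ds i) \<subseteq> set (cs i)) \<and>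
    minor_step\<^sup>*\<^sup>* (cycle_graph k cs) (cycle_graph k ds)"
  using assms(4)
proof (induction m)
  case 0
  with cs show ?case by blast
next
  case (Suc m)
  then obtain ds where ds: "\<And>i. i < m \<Longrightarrow> length (ds i) = r"
    "\<And>i. i < k \<Longrightarrow> distinct (ds i) \<and> r \<le> length (ds i) \<and> set (ds i) \<subseteq> set (cs i)"
    "minor_step\<^sup>*\<^sup>* (cycle_graph k cs) (cycle_graph k ds)" by auto
  have m: "m < k" using Suc.prems by simp
  define I U R where "I = {..<k} - {m}" and "U = (\<Union>i\<in>I. set (ds i))" and "R = (\<Union>i\<in>I. cycle_arcs (ds i))"
  have k: "{..<k} = insert m I" using m by (auto simp: I_def)
  have split: "cycle_graph k es = \<lparr>pverts = U \<union> set (es m), parcs = R \<union> cycle_arcs (es m)\<rparr>"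
    if "\<And>i. i \<in> I \<Longrightarrow> es i = ds i" for es
    unfolding cycle_graph_def k U_def R_def using that by (auto simp: Un_commute)
  have "U \<inter> set (ds m) = {}"
    using disj ds(2) m unfolding U_def I_def by blast
  moreover have "R \<subseteq> U \<times> U" using cycle_arcs_subset by (fastforce simp: R_def U_def)
  moreover have "irrefl R"
  proof -
    have "irrefl (cycle_arcs (ds i))" if "i \<in> I" for i
      using ds(2)[of i] that r by (intro irrefl_cycle_arcs) (auto simp: I_def)
    then show ?thesis by (auto simp: R_def irrefl_def)
  qed
  ultimately obtain ys where ys: "distinct ys" "length ys = r" "set ys \<subseteq> set (ds m)"
    "minor_step\<^sup>*\<^sup>* \<lparr>pverts = U \<union> set (ds m), parcs = R \<union> cycle_arcs (ds m)\<rparr>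
      \<lparr>pverts = U \<union> set ys, parcs = R \<union> cycle_arcs ys\<rparr>"
    using shrink_cycle[of "ds m" r U R] ds(2)[OF m] r by blast
  moreover have "cycle_graph k ds = \<lparr>pverts = U \<union> set (ds m), parcs = R \<union> cycle_arcs (ds m)\<rparr>"
    by (rule split) simp
  moreover have "cycle_graph k (ds(m := ys)) = \<lparr>pverts = U \<union> set ys, parcs = R \<union> cycle_arcs ys\<rparr>"
    using split[of "ds(m := ys)"] by (simp add: I_def)
  ultimately have step: "minor_step\<^sup>*\<^sup>* (cycle_graph k ds) (cycle_graph k (ds(m := ys)))" by simp
  show ?case
  proof (intro exI[of _ "ds(m := ys)"] conjI)
    show "minor_step\<^sup>*\<^sup>* (cycle_graph k cs) (cycle_graph k (ds(m := ys)))"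
      using ds(3) step by (rule rtranclp_trans)
    show "\<forall>i<k. distinct ((ds(m := ys)) i) \<and> r \<le> length ((ds(m := ys)) i) \<and> set ((ds(m := ys)) i) \<subseteq> set (cs i)"
    proof (intro allI impI)
      fix i assume "i < k"
      with ds(2)[OF this] ds(2)[OF m] ys(1-3)
      show "distinct ((ds(m := ys)) i) \<and> r \<le> length ((ds(m := ys)) i) \<and> set ((ds(m := ys)) i) \<subseteq> set (cs i)"
        by (cases "i = m") auto
    qed
    show "\<forall>i<Suc m. length ((ds(m := ys)) i) = r"
      using ds(1) ys(2) by (simp add: less_Suc_eq)
  qed
qed

text \<open>The vertex \<open>(i, a)\<close> goes to entry \<open>a\<close> of list
  \<open>i\<close>. Distinctness gives injectivity within a cycle, disjointness across
  cycles.\<close>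

lemma cycle_graph_iso:
  assumes "r \<ge> 2" and ds: "\<And>i. i < k \<Longrightarrow> distinct (ds i) \<and> length (ds i) = r"
    and disj: "\<And>i j. \<lbrakk>i < k; j < k; i \<noteq> j\<rbrakk> \<Longrightarrow> set (ds i) \<inter> set (ds j) = {}"
  shows "digraph_iso (with_proj (disjoint_cycles k r)) (with_proj (cycle_graph k ds))"
proof -
  define g where "g = (\<lambda>(i, a). ds i ! a)"
  let ?H = "disjoint_cycles k r"
  interpret H: pair_graph ?H by (rule disjoint_cycles_pair_graph[OF assms(1)])
  have inj: "inj_on g (pverts ?H)"
  proof (rule inj_onI)
    fix p q assume "p \<in> pverts ?H" "q \<in> pverts ?H" "g p = g q"
    then obtain i a j b where "p = (i, a)" "q = (j, b)" and ij: "i < k" "j < k" and ab: "a < r" "b < r"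
      and eq: "ds i ! a = ds j ! b"
      by (cases p; cases q) (auto simp: disjoint_cycles_def g_def)
    moreover have "ds i ! a \<in> set (ds i)" "ds j ! b \<in> set (ds j)" using ds ij ab by auto
    then have "i = j" using disj[OF ij] eq by auto
    moreover from this have "a = b" using ds[OF ij(1)] eq ab by (simp add: nth_eq_iff_index_eq)
    ultimately show "p = q" by simp
  qed
  have "inj_on (map_prod g g) (parcs ?H)"
    by (rule inj_on_subset[OF map_prod_inj_on[OF inj inj]])
      (use H.in_arcsD1 H.in_arcsD2 in auto)
  moreover define h where "h = \<lparr>iso_verts = g, iso_arcs = map_prod g g, iso_head = snd, iso_tail = fst\<rparr>"
  ultimately have "H.digraph_isomorphism h"
    using inj H.wf_digraph_axioms by (auto simp: H.digraph_isomorphism_def h_def)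
  moreover have "g ` pverts ?H = pverts (cycle_graph k ds)"
  proof -
    have "g ` pverts ?H = (\<Union>i<k. (!) (ds i) ` {..<r})"
      by (force simp: disjoint_cycles_def g_def)
    also have "\<dots> = (\<Union>i<k. set (ds i))"
    proof (intro SUP_cong refl)
      fix i assume "i \<in> {..<k}"
      then show "(!) (ds i) ` {..<r} = set (ds i)"
        using ds[of i] by (force simp: set_conv_nth)
    qed
    finally show ?thesis by (simp add: cycle_graph_def)
  qed
  moreover have "map_prod g g ` parcs ?H = parcs (cycle_graph k ds)"
  proof -
    have "map_prod g g ` parcs ?H = (\<Union>i<k. {(ds i ! a, ds i ! b) |a b. a < r \<and> b < r \<and>
        (b = Suc a mod r \<or> a = Suc b mod r)})"
      by (force simp: disjoint_cycles_def g_def image_iff)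
    also have "\<dots> = (\<Union>i<k. cycle_arcs (ds i))"
      using ds by (intro SUP_cong refl) (simp add: cycle_arcs_nth)
    finally show ?thesis by (simp add: cycle_graph_def)
  qed
  ultimately show ?thesis
    unfolding digraph_iso_def by (intro exI[of _ h]) (auto simp: app_iso_def h_def with_proj_def)
qed

text \<open>Deletions leave just the packed cycles, and contractions then bring each of them to
  length \<open>r\<close>.\<close>

lemma cycle_packing_minor:
  assumes G: "pair_graph G" and packing: "cycle_packing (parcs G) (pverts G) k r cs" and r: "r \<ge> 2"
  shows "is_minor (disjoint_cycles k r) G"
proof -
  interpret pair_graph G by fact
  interpret H: pair_graph "disjoint_cycles k r" by (rule disjoint_cycles_pair_graph[OF r])
  have cs: "distinct (cs i)" "r \<le> length (cs i)" "set (cs i) \<subseteq> pverts G" "set (zip (cs i) (rotate1 (cs i))) \<subseteq> parcs G"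
    if "i < k" for i
    using packing that by (auto simp: cycle_packing_def is_cycle_def)
  have arcs: "cycle_arcs (cs i) \<subseteq> parcs G" if "i < k" for i
    using cs(4)[OF that] arcs_symmetric unfolding cycle_arcs_def by blast
  have disj: "set (cs i) \<inter> set (cs j) = {}" if "i < k" "j < k" "i \<noteq> j" for i j
    using packing that by (auto simp: cycle_packing_def)
  have "pair_graph (cycle_graph k cs)"
  proof -
    have "irrefl (cycle_arcs (cs i))" if "i < k" for i
      using cs(1,2)[OF that] r by (intro irrefl_cycle_arcs) auto
    then show ?thesis using sym_cycle_arcs cycle_arcs_subset
      unfolding pair_graph_iff cycle_graph_def by (fastforce simp: irrefl_def sym_def)
  qed
  then have "minor_step\<^sup>*\<^sup>* G (cycle_graph k cs)"
    using cs(3) arcs by (intro subgraph_minor[OF G]) (auto simp: cycle_graph_def)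
  moreover obtain ds where ds: "\<forall>i<k. length (ds i) = r"
    "\<forall>i<k. distinct (ds i) \<and> r \<le> length (ds i) \<and> set (ds i) \<subseteq> set (cs i)"
    "minor_step\<^sup>*\<^sup>* (cycle_graph k cs) (cycle_graph k ds)"
    using shrink_cycles[of k cs r k] cs(1,2) r disj by blast
  ultimately have "minor_step\<^sup>*\<^sup>* G (cycle_graph k ds)" by simp
  moreover have "digraph_iso (with_proj (disjoint_cycles k r)) (with_proj (cycle_graph k ds))"
    using ds(1,2) disj by (intro cycle_graph_iso r) blast+
  then have "digraph_iso (with_proj (cycle_graph k ds)) (with_proj (disjoint_cycles k r))"
    by (rule digraph_iso_swap[OF H.wf_digraph_axioms])
  ultimately show ?thesis unfolding is_minor_def by blast
qed

theorem theorem2: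
  fixes k r :: nat and G :: "'a pair_pre_digraph"
  assumes "k \<ge> 6" and "r \<ge> 3"
    and "pair_graph G"
    and "avg_degree G \<ge> 4 / 3 * real k * real r"
  shows "is_minor (disjoint_cycles k r) G"
proof -
  have G: "finite (pverts G)" "parcs G \<subseteq> pverts G \<times> pverts G" "sym (parcs G)" "irrefl (parcs G)"
    using assms(3) by (simp_all add: pair_graph_iff)
  have kr: "real k * real r > 0" using assms(1,2) by simp
  \<comment> \<open>Without vertices the average degree is 0, since division by zero yields
    0.\<close>
  then have pos: "card (pverts G) > 0" using assms(4) by (cases "card (pverts G) = 0") (auto simp: avg_degree_def)
  have "vol (adjw (parcs G)) (pverts G) = card (parcs G)"
  proof -
    have "vol (adjw (parcs G)) (pverts G) = (\<Sum>e\<in>pverts G \<times> pverts G. of_bool (e \<in> parcs G))"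
      by (simp add: vol_def sum.cartesian_product case_prod_beta)
    also have "\<dots> = card (parcs G)"
      using G(1,2) by (simp add: of_bool_def sum.If_cases Int_absorb1)
    finally show ?thesis .
  qed
  also have "real (card (parcs G)) = avg_degree G * card (pverts G)"
    using pos card_parcs[OF assms(3)] by (simp add: avg_degree_def)
  \<comment> \<open>The factor on the right is \<open>4 * k * r / 3 - 2\<close>.\<close>
  also have "\<dots> \<ge> 2 * (2 * real k * real r / 3 - 1) * card (pverts G)"
    using assms(4) by (intro mult_right_mono) auto
  finally have "vol (adjw (parcs G)) (pverts G) \<ge> 2 * (2 * real k * real r / 3 - 1) * card (pverts G)" .
  then obtain cs where "cycle_packing (parcs G) (pverts G) k r cs"
    using dense_cycle_packing[OF G(3,4) assms(2) G(1)] pos assms(1) by fastforce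
  then show ?thesis using assms(2) by (intro cycle_packing_minor[OF assms(3)]) auto
qed

end
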